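(* Let $0\le p\le q+1$ be integers, let $a_1,\ldots,a_p>0$ and $b_1,\ldots,b_q>0$, put $r=q+1-p$, and suppose that $$\frac{e_{q+1}(1,b_1,\ldots,b_q)}{e_{p}(a_1,\ldots,a_{p})}\le\frac{e_{q}(1,b_1,\ldots,b_q)}{e_{p-1}(a_1,\ldots,a_{p})}\le\cdots\le\frac{e_{r+1}(1,b_1,\ldots,b_q)}{e_{1}(a_1,\ldots,a_{p})}\le e_{r}(1,b_1,\ldots,b_q)$$ (no condition if $p=0$). Denote $$g(\nu,x):=\frac{1}{\Gamma(\nu)}\,{}_pF_{q+1}(a_1,\ldots,a_p;\nu,b_1,\ldots,b_q;x).$$ Then: (1) for each fixed $x\ge0$ the function $\nu\mapsto g(\nu,x)$ is strictly discrete Wright log-concave on $(0,\infty)$. Moreover, for all real $\mu,\beta$ with $\mu\ge-1$, $\beta>0$, $\mu+\beta\ge0$, setting $\lambda_{\beta,\mu}(x):=g(\mu+1,x)g(\mu+\beta,x)-g(\mu,x)g(\mu+\beta+1,x)$: (2) all power series coefficients of $\lambda_{\beta,\mu}$ in powers of $x$ are positive, so that $\lambda_{\beta,\mu}$ is absolutely monotonic and multiplicatively convex on $(0,\infty)$; (3) $y\mapsto\lambda_{\beta,\mu}(1/y)$ is completely monotonic and log-convex on $(0,\infty)$, so that there exists a non-negative measure $\tau$ supported on $[0,\infty)$ such that $\lambda_{\beta,\mu}(x)=\int_{[0,\infty)}e^{-t/x}\,d\tau(t)$ for $x>0$; (4) $$\frac{\mu}{\beta+\mu}<\frac{g(\mu,x)g(1+\beta+\mu,x)}{g(1+\mu,x)g(\beta+\mu,x)}<1\quad\text{for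 all }x\ge0;$$ (5) for all $x\ge0$, $$g(\mu+1,x)g(\mu+\beta,x)-g(\mu,x)g(\mu+\beta+1,x)\ge\frac{\beta}{\Gamma(\mu+1)\Gamma(\mu+\beta+1)},$$ with equality only at $x=0$.
   Context: $\Gamma$ is Euler's gamma function; $1/\Gamma$ is regarded as an entire function (equal to $0$ at $0,-1,-2,\ldots$). $(a)_0=1$, $(a)_n=a(a+1)\cdots(a+n-1)$. $e_k$ is the $k$-th elementary symmetric polynomial of its arguments, $e_0=1$. The generalized hypergeometric function is ${}_pF_q(a_1,\ldots,a_p;b_1,\ldots,b_q;z)=\sum_{n\ge0}\frac{(a_1)_n\cdots(a_p)_n}{(b_1)_n\cdots(b_q)_n n!}z^n$; thus $g(\nu,x)=\sum_{n\ge0}\frac{(a_1)_n\cdots(a_p)_n}{(b_1)_n\cdots(b_q)_n n!}\frac{x^n}{\Gamma(\nu+n)}$, which also defines $g(\nu,x)$ when $\nu$ is a non-positive integer. A positive continuous function $F$ on an interval $I$ is discrete Wright log-concave if $F(\mu+h)F(\mu+s)-F(\mu)F(\mu+h+s)\ge0$ for all positive integers $h$, all real $s>0$ and all $\mu$ such that all arguments lie in $I$; strictly so if the inequality is strict. Log-convex means that $\log F$ is convex. Absolutely monotonic: the function and all its derivatives are non-negative. Completely monotonic on $(0,\infty)$: $(-1)^nF^{(n)}\ge0$ for all $n\ge0$. Multiplicatively convex on $(0,\infty)$: $\varphi(x^{\lambda}y^{1-\lambda})\le\varphi(x)^{\lambda}\varphi(y)^{1-\lambda}$ for all $x,y>0$,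 $\lambda\in[0,1]$.
   Formalization: In (2), positivity excludes n=0 if μ=-1 (and n=1 if also β=1); in (4), the lower bound is strict only for x>0, and undefined ratios or bounds (zero denominators) are left out; strictness and log-convexity exclude μ=-1, β=1, (a) a permutation of (1,b), where λ≡0. *)

theory Defs
  imports "HOL-Analysis.Analysis"
begin

definition elem_sym :: "nat \<Rightarrow> real list \<Rightarrow> real" where
  "elem_sym k xs = (\<Sum>S | S \<subseteq> {..<length xs} \<and> card S = k. \<Prod>i\<in>S. xs ! i)"

definition hyper_coeff :: "real list \<Rightarrow> real list \<Rightarrow> nat \<Rightarrow> real" where
  "hyper_coeff as bs n =
     (\<Prod>a\<leftarrow>as. pochhammer a n) / ((\<Prod>b\<leftarrow>bs. pochhammer b n) * fact n)"

(* The entire function rGamma = 1/Gamma is 0 at 0, -1, -2, ..., so this series is the definition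
   for every real nu. For the other nu it agrees with the normalised hypergeometric function
   of the library, see g_hyper_eq_fps_hypergeo below. *)
definition g_hyper :: "real list \<Rightarrow> real list \<Rightarrow> real \<Rightarrow> real \<Rightarrow> real" where
  "g_hyper as bs \<nu> x = (\<Sum>n. hyper_coeff as bs n * x ^ n * rGamma (\<nu> + real n))"

definition lam_hyper :: "real list \<Rightarrow> real list \<Rightarrow> real \<Rightarrow> real \<Rightarrow> real \<Rightarrow> real" where
  "lam_hyper as bs \<beta> \<mu> x =
     g_hyper as bs (\<mu> + 1) x * g_hyper as bs (\<mu> + \<beta>) x
     - g_hyper as bs \<mu> x * g_hyper as bs (\<mu> + \<beta> + 1) x"

definition strict_discrete_wright_log_concave_on :: "real set \<Rightarrow> (real \<Rightarrow> real) \<Rightarrow> bool" where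
  "strict_discrete_wright_log_concave_on I F \<longleftrightarrow>
     (\<forall>\<mu>\<in>I. F \<mu> > 0) \<and> continuous_on I F \<and>
     (\<forall>(h::nat) (s::real) (\<mu>::real). h > 0 \<and> s > 0 \<and>
        \<mu> \<in> I \<and> \<mu> + real h \<in> I \<and> \<mu> + s \<in> I \<and> \<mu> + real h + s \<in> I \<longrightarrow>
        F (\<mu> + real h) * F (\<mu> + s) - F \<mu> * F (\<mu> + real h + s) > 0)"

definition log_convex_on :: "real set \<Rightarrow> (real \<Rightarrow> real) \<Rightarrow> bool" where
  "log_convex_on I F \<longleftrightarrow> (\<forall>x\<in>I. F x > 0) \<and> convex_on I (\<lambda>x. ln (F x))"

(* Only meant for open S: deriv is the two-sided derivative. *)
definition infinitely_differentiable_on :: "real set \<Rightarrow> (real \<Rightarrow> real) \<Rightarrow> bool" where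
  "infinitely_differentiable_on S F \<longleftrightarrow>
     (\<forall>n. \<forall>x\<in>S. (deriv ^^ n) F field_differentiable (at x))"

definition absolutely_monotonic_on :: "real set \<Rightarrow> (real \<Rightarrow> real) \<Rightarrow> bool" where
  "absolutely_monotonic_on S F \<longleftrightarrow>
     infinitely_differentiable_on S F \<and> (\<forall>n. \<forall>x\<in>S. (deriv ^^ n) F x \<ge> 0)"

definition completely_monotonic_on :: "real set \<Rightarrow> (real \<Rightarrow> real) \<Rightarrow> bool" where
  "completely_monotonic_on S F \<longleftrightarrow>
     infinitely_differentiable_on S F \<and> (\<forall>n. \<forall>x\<in>S. (-1) ^ n * (deriv ^^ n) F x \<ge> 0)"

definition multiplicatively_convex :: "(real \<Rightarrow> real) \<Rightarrow> bool" where
  "multiplicatively_convex \<phi> \<longleftrightarrow>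
     (\<forall>x>0. \<forall>y>0. \<forall>t\<in>{0..1}.
        \<phi> (x powr t * y powr (1 - t)) \<le> \<phi> x powr t * \<phi> y powr (1 - t))"

lemma hyper_coeff_eq_fps_hypergeo: "hyper_coeff as bs n = fps_nth (fps_hypergeo as bs 1) n"
proof -
  have *: "foldl (\<lambda>r a. r * pochhammer a n) c xs = c * (\<Prod>a\<leftarrow>xs. pochhammer a n)"
    for c :: real and xs
    by (induction xs arbitrary: c) (simp_all add: mult_ac)
  show ?thesis
    unfolding hyper_coeff_def by (simp add: *)
qed

lemma summable_g_hyper:
  assumes "length as \<le> length bs + 1" and "\<forall>b\<in>set bs. b > 0"
  shows "summable (\<lambda>n. hyper_coeff as bs n * x ^ n * rGamma (\<nu> + real n))"
proof -
  define f where "f = (\<lambda>n. hyper_coeff as bs n * x ^ n * rGamma (\<nu> + real n))"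
  define Q where "Q = (\<lambda>xs n. \<Prod>a\<leftarrow>xs. (a + real n) / real n)"
  define R where "R = (\<lambda>n. Q as n / Q bs n * (real n / real (n + 1)) * (x / (\<nu> + real n)))"
  have Qlim: "Q xs \<longlonglongrightarrow> 1" for xs
  proof (induction xs)
    case Nil
    show ?case by (simp add: Q_def)
  next
    case (Cons a xs)
    have "(\<lambda>n. (a + real n) / real n) \<longlonglongrightarrow> 1"
    proof (rule Lim_transform_eventually)
      show "(\<lambda>n. a / real n + 1) \<longlonglongrightarrow> 1"
        using tendsto_add[OF lim_const_over_n[of a] tendsto_const[of "1::real"]] by simp
      show "\<forall>\<^sub>F n in sequentially. a / real n + 1 = (a + real n) / real n"
        using eventually_gt_at_top[of 0] by eventually_elim (simp add: field_simps)
    qed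
    from tendsto_mult[OF this Cons] show ?case by (simp add: Q_def)
  qed
  have "(\<lambda>n. real n / real (n + 1)) \<longlonglongrightarrow> 1"
    using LIMSEQ_n_over_Suc_n[where ?'a = real] by simp
  moreover have "(\<lambda>n. x / (\<nu> + real n)) \<longlonglongrightarrow> 0"
    by (intro tendsto_divide_0[OF tendsto_const] filterlim_at_top_imp_at_infinity
        filterlim_tendsto_add_at_top[OF tendsto_const] filterlim_real_sequentially)
  ultimately have "R \<longlonglongrightarrow> 1 / 1 * 1 * 0"
    unfolding R_def by (intro tendsto_mult tendsto_divide Qlim) auto
  hence "\<forall>\<^sub>F n in sequentially. \<bar>R n\<bar> < 1 / 2"
    using tendstoD[of R 0 sequentially "1/2"] by (simp add: dist_real_def)
  moreover have "\<forall>\<^sub>F n in sequentially. \<nu> + real n > 0"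
    by real_asymp
  ultimately have "\<forall>\<^sub>F n in sequentially. norm (f (Suc n)) \<le> 1 / 2 * norm (f n)"
    using eventually_gt_at_top[of 0]
  proof eventually_elim
    case (elim n)
    have P: "(\<Prod>a\<leftarrow>xs. pochhammer a (Suc n)) = (\<Prod>a\<leftarrow>xs. pochhammer a n) * Q xs n * real n ^ length xs"
      for xs :: "real list"
      using elim by (induction xs) (simp_all add: Q_def pochhammer_Suc)
    have bs: "(\<Prod>b\<leftarrow>bs. pochhammer b n) > 0" "Q bs n > 0"
      using assms(2) elim unfolding Q_def
      by (induction bs) (auto intro!: mult_pos_pos pochhammer_pos divide_pos_pos add_pos_nonneg)
    define d where "d = length bs + 1 - length as"
    have d: "length bs + 1 = length as + d"
      using assms(1) by (simp add: d_def)
    have nd: "real n ^ length bs * real n = real n ^ length as * real n ^ d"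
      using d by (metis power_add power_one_right)
    have "rGamma (\<nu> + real n) = (\<nu> + real n) * rGamma (\<nu> + real (Suc n))"
      using rGamma_plus1[of "\<nu> + real n"] by (simp add: add_ac)
    hence rG: "rGamma (\<nu> + real (Suc n)) = rGamma (\<nu> + real n) / (\<nu> + real n)"
      using elim by (simp add: field_simps)
    have "f (Suc n) * real n ^ d = f n * R n"
    proof -
      have "hyper_coeff as bs (Suc n) * real n ^ d =
        hyper_coeff as bs n * (Q as n / Q bs n) * (real n ^ length as * real n ^ d / (real n ^ length bs * real (n + 1)))"
        unfolding hyper_coeff_def P using bs elim by (simp add: field_simps)
      also have "\<dots> = hyper_coeff as bs n * (Q as n / Q bs n) * (real n / real (n + 1))"
        unfolding nd[symmetric] using elim by simp
      finally have h: "hyper_coeff as bs (Suc n) * real n ^ d =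
        hyper_coeff as bs n * (Q as n / Q bs n) * (real n / real (n + 1))" .
      have "f (Suc n) * real n ^ d =
        (hyper_coeff as bs (Suc n) * real n ^ d) * x ^ Suc n * rGamma (\<nu> + real (Suc n))"
        by (simp add: f_def)
      also have "\<dots> = f n * R n"
        unfolding h rG f_def R_def by simp
      finally show ?thesis .
    qed
    hence "\<bar>f (Suc n)\<bar> * real n ^ d = \<bar>f n\<bar> * \<bar>R n\<bar>"
      by (metis abs_mult abs_of_nonneg of_nat_0_le_iff zero_le_power)
    moreover have "real n ^ d \<ge> 1"
      using elim by simp
    hence "\<bar>f (Suc n)\<bar> * 1 \<le> \<bar>f (Suc n)\<bar> * real n ^ d"
      by (intro mult_left_mono) auto
    moreover have "\<bar>f n\<bar> * \<bar>R n\<bar> \<le> \<bar>f n\<bar> * (1 / 2)"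
      using elim by (intro mult_left_mono) auto
    ultimately show ?case by simp
  qed
  then obtain N where "\<And>n. n \<ge> N \<Longrightarrow> norm (f (Suc n)) \<le> 1 / 2 * norm (f n)"
    by (auto simp: eventually_at_top_linorder)
  thus ?thesis
    unfolding f_def[symmetric] by (intro summable_ratio_test[of "1/2" N]) auto
qed

lemma g_hyper_eq_fps_hypergeo:
  assumes "length as \<le> length bs + 1" and "\<forall>b\<in>set bs. b > 0" and "\<nu> \<notin> \<int>\<^sub>\<le>\<^sub>0"
  shows "g_hyper as bs \<nu> x = 1 / Gamma \<nu> * eval_fps (fps_hypergeo as (\<nu> # bs) 1) x"
proof -
  have G: "Gamma \<nu> \<noteq> 0"
    using assms(3) by (simp add: Gamma_eq_zero_iff)
  have *: "fps_nth (fps_hypergeo as (\<nu> # bs) 1) n * x ^ n =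
      Gamma \<nu> * (hyper_coeff as bs n * x ^ n * rGamma (\<nu> + real n))" for n
  proof -
    have p: "pochhammer \<nu> n \<noteq> 0"
      using assms(3) by (auto simp: pochhammer_eq_0_iff)
    have "rGamma (\<nu> + real n) = 1 / (Gamma \<nu> * pochhammer \<nu> n)"
      using pochhammer_rGamma[of \<nu> n] p G by (simp add: rGamma_inverse_Gamma field_simps)
    thus ?thesis
      unfolding hyper_coeff_eq_fps_hypergeo[symmetric] using p G
      by (simp add: hyper_coeff_def)
  qed
  show ?thesis
    unfolding g_hyper_def eval_fps_def * using G
    by (subst suminf_mult[OF summable_g_hyper[OF assms(1,2)]]) simp
qed

(* In this boundary case the determinant vanishes identically. *)
lemma lam_hyper_degenerate:
  assumes "mset as = mset (1 # bs)" and "\<forall>b\<in>set bs. b > 0"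
  shows "lam_hyper as bs 1 (-1) x = 0"
proof -
  have len: "length as \<le> length bs + 1"
    using mset_eq_length[OF assms(1)] by simp
  have c: "hyper_coeff as bs n = 1" for n
  proof -
    have "(\<Prod>a\<leftarrow>as. pochhammer a n) = (\<Prod>a\<leftarrow>1 # bs. pochhammer a n)"
      using assms(1) by (metis mset_map prod_mset_prod_list)
    moreover have "(\<Prod>b\<leftarrow>bs. pochhammer b n) > 0"
      using assms(2) by (induction bs) (auto intro!: mult_pos_pos pochhammer_pos)
    ultimately show ?thesis
      by (simp add: hyper_coeff_def pochhammer_fact[symmetric])
  qed
  have shift: "g_hyper as bs \<nu> x = x * g_hyper as bs (\<nu> + 1) x" if "rGamma \<nu> = 0" for \<nu>
  proof -
    have "g_hyper as bs \<nu> x = (\<Sum>n. x ^ Suc n * rGamma (\<nu> + real (Suc n)))"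
      using suminf_split_head[OF summable_g_hyper[OF len assms(2), of x \<nu>]] that
      by (simp add: g_hyper_def c)
    also have "\<dots> = (\<Sum>n. x * (hyper_coeff as bs n * x ^ n * rGamma (\<nu> + 1 + real n)))"
      by (simp add: c add_ac mult_ac)
    also have "\<dots> = x * g_hyper as bs (\<nu> + 1) x"
      unfolding g_hyper_def by (rule suminf_mult[OF summable_g_hyper[OF len assms(2)]])
    finally show ?thesis .
  qed
  have "g_hyper as bs 0 x = x * g_hyper as bs 1 x" "g_hyper as bs (-1) x = x * g_hyper as bs 0 x"
    using shift[of 0] shift[of "-1"] rGamma_plus1[of "-1 :: real"] by auto
  thus ?thesis
    by (simp add: lam_hyper_def)
qed

end

theory Submission
  imports Defs "HOL-Probability.Distributions"
begin

text \<open>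
  Write \<open>h\<close> for the coefficients of the hypergeometric series. The chain of inequalities between the
  elementary symmetric polynomials makes the rational function \<open>den / num\<close>, whose value at \<open>n\<close> is
  \<open>h n / h (n + 1)\<close>, nondecreasing, and strictly increasing unless \<open>num = den\<close>; hence \<open>h\<close> is
  log-concave. The \<open>m\<close>-th coefficient of \<open>\<lambda>\<close> is a sum of \<open>w k * (T (k + 1) - T k)\<close> with the symmetric
  weights \<open>w k = h k * h (m - k)\<close> and \<open>T k = 1 / (\<Gamma> (\<mu> + k) * \<Gamma> (\<mu> + \<beta> + m + 1 - k))\<close>. Summation by
  parts together with the reflection \<open>k \<mapsto> m + 1 - k\<close> turns it into a sum of terms
  \<open>(w k - w (k - 1)) * (T (m + 1 - k) - T k)\<close> whose factors have the same sign: the first by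
  log-concavity of \<open>h\<close>, the second because Pochhammer symbols increase. Everything else
  follows from the positivity of these coefficients, except the lower bound of the ratio, where the
  Cauchy product is positive after pairing the \<open>k\<close>-th term with the \<open>(m - k)\<close>-th.
\<close>

section \<open>Elementary symmetric polynomials\<close>

lemma elem_sym_0 [simp]: "elem_sym 0 xs = 1"
proof -
  have "{S. S \<subseteq> {..<length xs} \<and> card S = 0} = {{}}"
    by (auto dest: finite_subset)
  thus ?thesis by (simp add: elem_sym_def)
qed

lemma elem_sym_pos:
  assumes "\<forall>x\<in>set xs. x > 0" and "k \<le> length xs"
  shows "elem_sym k xs > 0"
  unfolding elem_sym_def
proof (rule sum_pos)
  show "finite {S. S \<subseteq> {..<length xs} \<and> card S = k}" by simp
  have "{..<k} \<in> {S. S \<subseteq> {..<length xs} \<and> card S = k}" using assms(2) by auto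
  thus "{S. S \<subseteq> {..<length xs} \<and> card S = k} \<noteq> {}" by blast
  show "(\<Prod>i\<in>S. xs ! i) > 0" if "S \<in> {S. S \<subseteq> {..<length xs} \<and> card S = k}" for S
    using that assms(1) by (intro prod_pos) (auto simp: subset_iff)
qed

lemma prod_list_add_eq_elem_sym:
  "(\<Prod>a\<leftarrow>xs. a + y) = (\<Sum>k\<le>length xs. elem_sym k xs * y ^ (length xs - k))"
proof -
  define n where "n = length xs"
  have "(\<Prod>a\<leftarrow>xs. a + y) = (\<Prod>i<n. xs ! i + y)"
    by (simp add: prod.list_conv_set_nth n_def atLeast0LessThan)
  also have "\<dots> = (\<Sum>X\<in>Pow {..<n}. (\<Prod>i\<in>X. xs ! i) * (\<Prod>i\<in>{..<n} - X. y))"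
    by (rule prod_add) simp
  also have "\<dots> = (\<Sum>X\<in>Pow {..<n}. (\<Prod>i\<in>X. xs ! i) * y ^ (n - card X))"
    by (intro sum.cong refl) (auto simp: card_Diff_subset finite_subset)
  also have "\<dots> = (\<Sum>k\<le>n. \<Sum>X\<in>{X\<in>Pow {..<n}. card X = k}. (\<Prod>i\<in>X. xs ! i) * y ^ (n - card X))"
    using card_mono[of "{..<n}"] by (intro sum.group[symmetric]) auto
  also have "\<dots> = (\<Sum>k\<le>n. elem_sym k xs * y ^ (n - k))"
    by (simp add: elem_sym_def sum_distrib_right n_def)
  finally show ?thesis by (simp add: n_def)
qed

text \<open>Unique factorisation: both lists are the negated roots, with multiplicity, of one
  polynomial, so linear factors cancel one by one. This turns the equality case
  \<open>num = den\<close> into \<open>mset as = mset (1 # bs)\<close>.\<close>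

lemma mset_eq_if_prod_list_add_eq:
  fixes xs ys :: "real list"
  assumes "\<And>y. (\<Prod>a\<leftarrow>xs. a + y) = (\<Prod>b\<leftarrow>ys. b + y)"
  shows "mset xs = mset ys"
proof -
  have poly: "poly (\<Prod>a\<in>#mset zs. [:a, 1:]) = (\<lambda>y. \<Prod>a\<leftarrow>zs. a + y)" for zs :: "real list"
    by (induction zs) (auto simp: fun_eq_iff algebra_simps)
  have "(\<Prod>a\<in>#mset xs. [:a, 1:]) = (\<Prod>b\<in>#mset ys. [:b, 1:])"
    by (subst poly_eq_poly_eq_iff [symmetric]) (simp only: poly assms)
  moreover have "A = B" if "(\<Prod>a\<in>#A. [:a, 1:]) = (\<Prod>b\<in>#B. [:b, 1:])" for A B :: "real multiset"
    using that
  proof (induction A arbitrary: B)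
    case empty
    have "poly (\<Prod>c\<in>#B. [:c, 1:]) (-b) = 0" if "b \<in># B" for b
      using that by (induction B) auto
    moreover have "poly (\<Prod>c\<in>#B. [:c, 1:]) y = 1" for y
      by (simp flip: empty)
    ultimately show ?case by (metis multiset_nonemptyE zero_neq_one)
  next
    case (add a A)
    have "poly (\<Prod>b\<in>#B. [:b, 1:]) (-a) = 0"
      by (simp flip: add.prems)
    hence "a \<in># B"
      by (induction B) auto
    then obtain B' where B: "B = add_mset a B'"
      by (metis insert_DiffM)
    \<comment> \<open>\<open>mult_pCons_left\<close> would multiply out the common factor
      \<open>[:a, 1:]\<close> that has to be cancelled.\<close>
    show ?case
      using add.IH[of B'] add.prems by (simp add: B del: mult_pCons_left)
  qed
  ultimately show ?thesis by blast
qed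

text \<open>Twice the difference of the two sides is a double sum over \<open>(i, l)\<close> whose summands are
  products of two factors that are antisymmetric in \<open>(i, l)\<close> and have the same sign.\<close>
lemma cross_product_mono:
  fixes \<alpha> \<beta> :: "nat \<Rightarrow> real" and N :: nat
  defines "A \<equiv> \<lambda>t. \<Sum>i\<le>N. \<alpha> i * t ^ (N - i)" and "B \<equiv> \<lambda>t. \<Sum>i\<le>N. \<beta> i * t ^ (N - i)"
  assumes cross: "\<And>i l. i < l \<Longrightarrow> l \<le> N \<Longrightarrow> \<beta> l * \<alpha> i \<le> \<beta> i * \<alpha> l"
    and xy: "0 \<le> x" "x < y"
  shows "B x * A y \<le> B y * A x"
    and "\<beta> N * \<alpha> 0 < \<beta> 0 * \<alpha> N \<Longrightarrow> N > 0 \<Longrightarrow> B x * A y < B y * A x"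
proof -
  define D where "D = (\<lambda>(i, l). (\<beta> i * \<alpha> l - \<beta> l * \<alpha> i) *
    (y ^ (N - i) * x ^ (N - l) - x ^ (N - i) * y ^ (N - l)))"
  have D_eq: "D (i, l) = (\<beta> i * y ^ (N - i)) * (\<alpha> l * x ^ (N - l)) - (\<beta> i * x ^ (N - i)) * (\<alpha> l * y ^ (N - l))
      - (\<alpha> i * y ^ (N - i)) * (\<beta> l * x ^ (N - l)) + (\<alpha> i * x ^ (N - i)) * (\<beta> l * y ^ (N - l))" for i l
    by (simp add: D_def algebra_simps)
  have "(\<Sum>i\<le>N. \<Sum>l\<le>N. D (i, l)) = B y * A x - B x * A y - A y * B x + A x * B y"
    unfolding A_def B_def sum_product D_eq sum.distrib sum_subtractf ..
  hence "2 * (B y * A x - B x * A y) = (\<Sum>i\<le>N. \<Sum>l\<le>N. D (i, l))"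
    by simp
  hence eq: "2 * (B y * A x - B x * A y) = sum D ({..N} \<times> {..N})"
    by (simp add: sum.cartesian_product)
  have powers: "x ^ (N - i) * y ^ (N - l) \<le> y ^ (N - i) * x ^ (N - l)" if "i < l" "l \<le> N" for i l
  proof -
    have "N - i = (N - l) + (l - i)" using that by simp
    moreover have "x ^ (l - i) \<le> y ^ (l - i)" using xy by (intro power_mono) auto
    ultimately show ?thesis
      using mult_left_mono[of "x ^ (l - i)" "y ^ (l - i)" "x ^ (N - l) * y ^ (N - l)"] xy
      by (simp add: power_add mult_ac)
  qed
  have sym: "D (i, l) = D (l, i)" for i l by (simp add: D_def algebra_simps)
  have nonneg: "D (i, l) \<ge> 0" if "i \<le> N" "l \<le> N" for i l
  proof -
    have "D (i, l) \<ge> 0" if "i < l" "l \<le> N" for i l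
      unfolding D_def using cross[OF that] powers[OF that] by simp
    from this[of i l] this[of l i] that show ?thesis
      by (cases i l rule: linorder_cases) (auto simp: sym, simp add: D_def)
  qed
  show "B x * A y \<le> B y * A x"
    using eq sum_nonneg[of "{..N} \<times> {..N}" D] nonneg by force
  assume *: "\<beta> N * \<alpha> 0 < \<beta> 0 * \<alpha> N" "N > 0"
  \<comment> \<open>One strict summand is enough. The pair \<open>(0, N)\<close> compares the
    coefficients of \<open>t ^ N\<close> with the constant ones.\<close>
  have "D (0, N) > 0"
    unfolding D_def using * xy power_strict_mono[of x y N] by simp
  hence "sum D ({..N} \<times> {..N}) > 0"
    using nonneg by (intro sum_pos2[of _ "(0, N)"]) auto
  thus "B x * A y < B y * A x" using eq by simp
qed

section \<open>Power series with nonnegative coefficients\<close>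

text \<open>Convergence on the whole line, negative \<open>x\<close> included, spares any radius of
  convergence and makes the class closed under \<open>deriv\<close>.\<close>

definition nonneg_power_series :: "(nat \<Rightarrow> real) \<Rightarrow> (real \<Rightarrow> real) \<Rightarrow> bool" where
  "nonneg_power_series c f \<longleftrightarrow> (\<forall>n. c n \<ge> 0) \<and> (\<forall>x. (\<lambda>n. c n * x ^ n) sums f x)"

lemma nonneg_power_seriesD:
  assumes "nonneg_power_series c f"
  shows "c n \<ge> 0" "(\<lambda>n. c n * x ^ n) sums f x" "summable (\<lambda>n. c n * x ^ n)" "f x = (\<Sum>n. c n * x ^ n)"
  using assms by (auto simp: nonneg_power_series_def sums_iff)

lemma nonneg_power_series_nonneg:
  assumes "nonneg_power_series c f" "x \<ge> 0"
  shows "f x \<ge> 0"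
  unfolding nonneg_power_seriesD(4)[OF assms(1)]
  using assms(2) nonneg_power_seriesD(1,3)[OF assms(1)] by (intro suminf_nonneg) auto

lemma nonneg_power_series_ge_partial:
  assumes "nonneg_power_series c f" "x \<ge> 0" "finite I"
  shows "(\<Sum>n\<in>I. c n * x ^ n) \<le> f x"
proof -
  have "(\<Sum>n\<in>I. c n * x ^ n) \<le> (\<Sum>n. c n * x ^ n)"
    using assms(2,3) nonneg_power_seriesD(1,3)[OF assms(1)] by (intro sum_le_suminf) auto
  thus ?thesis unfolding nonneg_power_seriesD(4)[OF assms(1), of x] .
qed

lemma nonneg_power_series_pos:
  assumes "nonneg_power_series c f" "x > 0" "c n > 0"
  shows "f x > 0"
proof -
  have "0 < c n * x ^ n" using assms(2,3) by simp
  also have "\<dots> \<le> f x"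
    using nonneg_power_series_ge_partial[OF assms(1), of x "{n}"] assms(2) by simp
  finally show ?thesis .
qed

lemma nonneg_power_series_mono:
  assumes "nonneg_power_series c f" "0 \<le> x" "x \<le> y"
  shows "f x \<le> f y"
  by (rule sums_le[OF _ nonneg_power_seriesD(2)[OF assms(1)] nonneg_power_seriesD(2)[OF assms(1)]])
     (intro mult_left_mono power_mono nonneg_power_seriesD(1)[OF assms(1)] assms(2,3))

lemma nonneg_power_series_deriv:
  assumes "nonneg_power_series c f"
  shows "(f has_field_derivative deriv f x) (at x)" and "nonneg_power_series (diffs c) (deriv f)"
proof -
  have f: "f = (\<lambda>x. \<Sum>n. c n * x ^ n)"
    by (intro ext nonneg_power_seriesD(4)[OF assms])
  have D: "(f has_field_derivative (\<Sum>n. diffs c n * x ^ n)) (at x)" for x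
    unfolding f by (rule termdiffs_strong_converges_everywhere) (rule nonneg_power_seriesD(3)[OF assms])
  hence deriv: "deriv f x = (\<Sum>n. diffs c n * x ^ n)" for x
    by (rule DERIV_imp_deriv)
  show "(f has_field_derivative deriv f x) (at x)"
    using D deriv by simp
  have "summable (\<lambda>n. diffs c n * x ^ n)" for x
    by (rule termdiff_converges_all) (rule nonneg_power_seriesD(3)[OF assms])
  moreover have "diffs c n \<ge> 0" for n
    using nonneg_power_seriesD(1)[OF assms] by (simp add: diffs_def)
  ultimately show "nonneg_power_series (diffs c) (deriv f)"
    by (simp add: nonneg_power_series_def deriv summable_sums)
qed

lemma nonneg_power_series_higher_deriv:
  assumes "nonneg_power_series c f"
  shows "nonneg_power_series ((diffs ^^ n) c) ((deriv ^^ n) f)"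
  by (induction n) (auto simp: assms nonneg_power_series_deriv(2))

section \<open>Monotonicity, convexity and Laplace representation of such series\<close>

lemma absolutely_monotonic_on_power_series:
  assumes "nonneg_power_series c f"
  shows "absolutely_monotonic_on {0<..} f"
  unfolding absolutely_monotonic_on_def infinitely_differentiable_on_def field_differentiable_def
proof (intro conjI allI ballI)
  fix n x
  note p = nonneg_power_series_higher_deriv[OF assms, of n]
  show "\<exists>D. ((deriv ^^ n) f has_field_derivative D) (at x)"
    using nonneg_power_series_deriv(1)[OF p] by blast
  show "(deriv ^^ n) f x \<ge> 0" if "x \<in> {0<..}"
    using nonneg_power_series_nonneg[OF p] that by simp
qed

lemma nonneg_power_series_square_mult:
  assumes "nonneg_power_series c f"
  shows "nonneg_power_series (\<lambda>n. if n < 2 then 0 else c (n - 2)) (\<lambda>x. x\<^sup>2 * f x)"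
  unfolding nonneg_power_series_def
proof (intro conjI allI)
  fix x
  define a where "a = (\<lambda>n. (if n < 2 then 0 else c (n - 2)) * x ^ n)"
  have "(\<lambda>n. x\<^sup>2 * (c n * x ^ n)) sums (x\<^sup>2 * f x)"
    by (intro sums_mult nonneg_power_seriesD(2)[OF assms])
  moreover have "x\<^sup>2 * (c n * x ^ n) = a (n + 2)" for n
    unfolding a_def power_add by simp
  ultimately have "(\<lambda>n. a (n + 2)) sums (x\<^sup>2 * f x)" by simp
  hence "a sums (x\<^sup>2 * f x)"
    by (subst (asm) sums_zero_iff_shift) (simp_all add: a_def)
  thus "(\<lambda>n. (if n < 2 then 0 else c (n - 2)) * x ^ n) sums (x\<^sup>2 * f x)"
    by (simp only: a_def)
qed (use nonneg_power_seriesD(1)[OF assms] in auto)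

text \<open>Differentiating \<open>p (1 / y)\<close> gives \<open>- P (1 / y)\<close> with \<open>P x = x\<^sup>2 * p' x\<close>, which is again
  a power series with nonnegative coefficients.\<close>
lemma higher_deriv_power_series_inverse:
  assumes "nonneg_power_series c f"
  shows "\<exists>d p. nonneg_power_series d p \<and>
    (\<forall>y>0. (deriv ^^ n) (\<lambda>y. f (1 / y)) y = (-1) ^ n * p (1 / y) \<and>
      (deriv ^^ n) (\<lambda>y. f (1 / y)) field_differentiable (at y))"
proof -
  have D: "((\<lambda>y. (-1) ^ n * p (1 / y)) has_field_derivative (-1) ^ Suc n * ((1 / y)\<^sup>2 * deriv p (1 / y))) (at y)"
    if "nonneg_power_series d p" "y > 0" for d p y and n :: nat
  proof -
    have "((\<lambda>y. 1 / y) has_field_derivative - ((1 / y)\<^sup>2)) (at y)"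
      using that(2) by (auto intro!: derivative_eq_intros simp: power2_eq_square)
    from DERIV_chain2[OF nonneg_power_series_deriv(1)[OF that(1)] this]
    have "((\<lambda>y. p (1 / y)) has_field_derivative deriv p (1 / y) * - ((1 / y)\<^sup>2)) (at y)" .
    from DERIV_cmult[OF this, of "(-1) ^ n"] show ?thesis by (simp add: mult_ac)
  qed
  have "\<exists>d p. nonneg_power_series d p \<and> (\<forall>y>0. (deriv ^^ n) (\<lambda>y. f (1 / y)) y = (-1) ^ n * p (1 / y))" for n
  proof (induction n)
    case 0
    show ?case by (intro exI[of _ c] exI[of _ f]) (simp add: assms)
  next
    case (Suc n)
    then obtain d p where p: "nonneg_power_series d p"
      and eq: "\<And>y. y > 0 \<Longrightarrow> (deriv ^^ n) (\<lambda>y. f (1 / y)) y = (-1) ^ n * p (1 / y)"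
      by blast
    have "(deriv ^^ Suc n) (\<lambda>y. f (1 / y)) y = (-1) ^ Suc n * ((1 / y)\<^sup>2 * deriv p (1 / y))" if "y > 0" for y
    proof -
      have "((deriv ^^ n) (\<lambda>y. f (1 / y)) has_field_derivative
          (-1) ^ Suc n * ((1 / y)\<^sup>2 * deriv p (1 / y))) (at y)"
        by (rule has_field_derivative_transform_within_open[OF D[OF p that], of "{0<..}"])
           (use that eq in auto)
      thus ?thesis by (simp add: DERIV_imp_deriv)
    qed
    thus ?case
      using nonneg_power_series_square_mult[OF nonneg_power_series_deriv(2)[OF p]]
      by (intro exI[of _ "\<lambda>x. x\<^sup>2 * deriv p x"] exI conjI) auto
  qed
  then obtain d p where p: "nonneg_power_series d p"
    and eq: "\<And>y. y > 0 \<Longrightarrow> (deriv ^^ n) (\<lambda>y. f (1 / y)) y = (-1) ^ n * p (1 / y)"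
    by blast
  have "(deriv ^^ n) (\<lambda>y. f (1 / y)) field_differentiable (at y)" if "y > 0" for y
    unfolding field_differentiable_def
    by (rule exI, rule has_field_derivative_transform_within_open[OF D[OF p that], of "{0<..}"])
       (use that eq in auto)
  thus ?thesis using p eq by (intro exI[of _ d] exI[of _ p]) simp
qed

lemma completely_monotonic_on_power_series_inverse:
  assumes "nonneg_power_series c f"
  shows "completely_monotonic_on {0<..} (\<lambda>y. f (1 / y))"
  unfolding completely_monotonic_on_def infinitely_differentiable_on_def
proof (intro conjI allI ballI)
  fix n and y :: real assume y: "y \<in> {0<..}"
  obtain d p where p: "nonneg_power_series d p"
    "(deriv ^^ n) (\<lambda>y. f (1 / y)) y = (-1) ^ n * p (1 / y)"
    "(deriv ^^ n) (\<lambda>y. f (1 / y)) field_differentiable (at y)"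
    using higher_deriv_power_series_inverse[OF assms, of n] y by auto
  show "(deriv ^^ n) (\<lambda>y. f (1 / y)) field_differentiable (at y)" by fact
  have "(-1) ^ n * (deriv ^^ n) (\<lambda>y. f (1 / y)) y = p (1 / y)"
    by (simp add: p(2) flip: mult.assoc power_mult_distrib)
  thus "(-1) ^ n * (deriv ^^ n) (\<lambda>y. f (1 / y)) y \<ge> 0"
    using nonneg_power_series_nonneg[OF p(1)] y by simp
qed

text \<open>Hoelder's inequality for the series, proved by summing Young's inequality termwise.\<close>
lemma multiplicatively_convex_power_series:
  assumes "nonneg_power_series c f"
  shows "multiplicatively_convex f"
  unfolding multiplicatively_convex_def
proof (intro allI impI ballI)
  fix x y t :: real assume x: "x > 0" and y: "y > 0" and t: "t \<in> {0..1}"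
  show "f (x powr t * y powr (1 - t)) \<le> f x powr t * f y powr (1 - t)"
  proof (cases "\<forall>n. c n = 0")
    case True
    have "f z = 0" for z
      using nonneg_power_seriesD(2)[OF assms, of z] True by (simp add: sums_iff)
    thus ?thesis by simp
  next
    case False
    then obtain n where "c n > 0"
      using nonneg_power_seriesD(1)[OF assms] by (metis less_eq_real_def)
    hence pos: "f x > 0" "f y > 0"
      using nonneg_power_series_pos[OF assms] x y by blast+
    define z where "z = x powr t * y powr (1 - t)"
    define M where "M = f x powr t * f y powr (1 - t)"
    have M: "M > 0" using pos by (simp add: M_def)
    \<comment> \<open>The terms are divided by \<open>f x\<close> and \<open>f y\<close> before
      Young's inequality, so each normalised series has sum 1 and the bounds add up to exactly
      \<open>M\<close>.\<close>
    have "c n * z ^ n \<le> M * (t * (c n * x ^ n / f x) + (1 - t) * (c n * y ^ n / f y))" for n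
    proof (cases "c n = 0")
      case False
      hence c: "c n > 0" using nonneg_power_seriesD(1)[OF assms, of n] by simp
      have "(c n * x ^ n / f x) powr t * (c n * y ^ n / f y) powr (1 - t) \<le>
          t * (c n * x ^ n / f x) + (1 - t) * (c n * y ^ n / f y)"
        using c x y pos t by (intro Youngs_inequality_0) auto
      moreover have "M * ((c n * x ^ n / f x) powr t * (c n * y ^ n / f y) powr (1 - t)) =
          (c n powr t * c n powr (1 - t)) * ((x ^ n) powr t * (y ^ n) powr (1 - t))"
        using c x y pos by (simp add: M_def powr_mult powr_divide)
      moreover have "c n powr t * c n powr (1 - t) = c n"
        using c by (simp flip: powr_add)
      moreover have "(x ^ n) powr t * (y ^ n) powr (1 - t) = z ^ n"
        using x y by (simp add: z_def power_mult_distrib powr_powr mult.commute flip: powr_realpow)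
      ultimately show ?thesis
        using mult_left_mono[OF _ less_imp_le[OF M]] by metis
    qed simp
    moreover have "(\<lambda>n. M * (t * (c n * x ^ n / f x) + (1 - t) * (c n * y ^ n / f y))) sums
        (M * (t * (f x / f x) + (1 - t) * (f y / f y)))"
      by (intro sums_mult sums_add sums_divide nonneg_power_seriesD(2)[OF assms])
    ultimately have "f z \<le> M * (t * (f x / f x) + (1 - t) * (f y / f y))"
      by (rule sums_le[OF _ nonneg_power_seriesD(2)[OF assms]])
    thus ?thesis using pos by (simp add: z_def M_def)
  qed
qed

text \<open>By weighted AM-GM the reciprocal of a convex combination is at most the weighted
  geometric mean of the reciprocals; monotonicity and multiplicative convexity of \<open>f\<close>
  then give the claim after taking logarithms. A positive coefficient keeps the logarithms
  meaningful.\<close>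

lemma log_convex_on_power_series_inverse:
  assumes "nonneg_power_series c f" "c n > 0"
  shows "log_convex_on {0<..} (\<lambda>y. f (1 / y))"
proof -
  have pos: "f (1 / y) > 0" if "y > 0" for y
    using nonneg_power_series_pos[OF assms(1) _ assms(2)] that by simp
  have "convex_on {0<..} (\<lambda>y. ln (f (1 / y)))"
  proof (rule convex_onI)
    fix t x y :: real assume t: "0 < t" "t < 1" and x: "x \<in> {0<..}" and y: "y \<in> {0<..}"
    have "x powr (1 - t) * y powr t \<le> (1 - t) * x + t * y"
      using t x y by (intro Youngs_inequality_0) auto
    hence "1 / ((1 - t) * x + t * y) \<le> 1 / (x powr (1 - t) * y powr t)"
      using x y by (intro divide_left_mono) (auto simp: add_pos_pos t intro!: mult_pos_pos add_pos_pos)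
    also have "\<dots> = (1 / x) powr (1 - t) * (1 / y) powr (1 - (1 - t))"
      using x y by (simp add: powr_divide)
    finally have "f (1 / ((1 - t) * x + t * y)) \<le> f ((1 / x) powr (1 - t) * (1 / y) powr (1 - (1 - t)))"
      using t x y by (intro nonneg_power_series_mono[OF assms(1)]) (auto intro!: add_nonneg_nonneg)
    also have "\<dots> \<le> f (1 / x) powr (1 - t) * f (1 / y) powr (1 - (1 - t))"
      using multiplicatively_convex_power_series[OF assms(1), unfolded multiplicatively_convex_def,
        rule_format, of "1 / x" "1 / y" "1 - t"] x y t by simp
    finally have "ln (f (1 / ((1 - t) * x + t * y))) \<le> ln (f (1 / x) powr (1 - t) * f (1 / y) powr t)"
      using pos[of "(1 - t) * x + t * y"] t x y by (subst ln_le_cancel_iff) (simp_all add: add_pos_pos)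
    also have "\<dots> = (1 - t) * ln (f (1 / x)) + t * ln (f (1 / y))"
      using pos[of x] pos[of y] x y by (simp add: ln_mult ln_powr)
    finally show "ln (f (1 / ((1 - t) *\<^sub>R x + t *\<^sub>R y))) \<le> (1 - t) * ln (f (1 / x)) + t * ln (f (1 / y))"
      by simp
  qed auto
  thus ?thesis unfolding log_convex_on_def using pos by auto
qed

text \<open>The atom of mass \<open>c 0\<close> at the origin is the image under \<open>max 0\<close> of Lebesgue measure,
  scaled by \<open>c 0\<close>, on \<open>(-1, 0)\<close>.\<close>
lemma power_series_laplace_measure:
  assumes "nonneg_power_series c f"
  shows "\<exists>\<tau> :: real measure. sets \<tau> = sets borel \<and> emeasure \<tau> {..<0} = 0 \<and>
    (\<forall>x>0. set_integrable \<tau> {0..} (\<lambda>t. exp (- t / x)) \<and> f x = (LINT t:{0..}|\<tau>. exp (- t / x)))"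
proof -
  \<comment> \<open>The Laplace transform of \<open>t ^ k / fact k\<close> at \<open>1 / x\<close>
    is \<open>x ^ Suc k\<close>, an Erlang density up to scaling; so the \<open>n\<close>-th weight
    represents \<open>x ^ n\<close>, and the series is represented by the weights with factors
    \<open>c n\<close>.\<close>
  define \<phi> :: "nat \<Rightarrow> real \<Rightarrow> real" where
    "\<phi> = (\<lambda>n t. case n of 0 \<Rightarrow> indicator {-1<..<0} t | Suc k \<Rightarrow> indicator {0..} t * t ^ k / fact k)"
  define \<rho> where "\<rho> = (\<lambda>t. \<Sum>n. ennreal (c n) * ennreal (\<phi> n t))"
  define \<tau> where "\<tau> = distr (density lborel \<rho>) borel (max (0 :: real))"
  have [measurable]: "\<phi> n \<in> borel_measurable borel" for n
    by (cases n) (simp_all add: \<phi>_def)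
  have [measurable]: "\<rho> \<in> borel_measurable borel"
    unfolding \<rho>_def by measurable
  have c: "c n \<ge> 0" for n by (rule nonneg_power_seriesD(1)[OF assms])
  have \<phi>: "(\<integral>\<^sup>+ t. ennreal (\<phi> n t) * ennreal (exp (- (max 0 t / x))) \<partial>lborel) = ennreal (x ^ n)" if "x > 0" for x n
  proof (cases n)
    case 0
    have "(\<integral>\<^sup>+ t. ennreal (\<phi> n t) * ennreal (exp (- (max 0 t / x))) \<partial>lborel) =
        (\<integral>\<^sup>+ t. indicator {-1<..<0 :: real} t \<partial>lborel)"
      by (intro nn_integral_cong) (auto simp: \<phi>_def 0 split: split_indicator)
    thus ?thesis using 0 by simp
  next
    case (Suc k)
    have "(\<integral>\<^sup>+ t. ennreal (\<phi> n t) * ennreal (exp (- (max 0 t / x))) \<partial>lborel) =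
        (\<integral>\<^sup>+ t. ennreal (x ^ n) * ennreal (erlang_density k (1 / x) t * t ^ 0) \<partial>lborel)"
      using that
      by (intro nn_integral_cong)
         (auto simp: \<phi>_def Suc erlang_density_def power_divide field_simps ennreal_mult'[symmetric]
           split: split_indicator)
    also have "\<dots> = ennreal (x ^ n) * 1"
      using nn_integral_erlang_ith_moment[of "1 / x" k 0] that
      by (subst nn_integral_cmult) simp_all
    finally show ?thesis by simp
  qed
  have int: "(\<integral>\<^sup>+ t. ennreal (indicator {0..} t * exp (- t / x)) \<partial>\<tau>) = ennreal (f x)" if "x > 0" for x
  proof -
    have "(\<integral>\<^sup>+ t. ennreal (indicator {0..} t * exp (- t / x)) \<partial>\<tau>) =
        (\<integral>\<^sup>+ t. \<rho> t * ennreal (exp (- (max 0 t / x))) \<partial>lborel)"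
      unfolding \<tau>_def by (simp add: nn_integral_distr nn_integral_density)
    also have "\<dots> = (\<integral>\<^sup>+ t. (\<Sum>n. ennreal (c n) * (ennreal (\<phi> n t) * ennreal (exp (- (max 0 t / x))))) \<partial>lborel)"
      unfolding \<rho>_def by (simp add: ennreal_suminf_multc[symmetric] mult.assoc)
    also have "\<dots> = (\<Sum>n. ennreal (c n) * ennreal (x ^ n))"
      by (subst nn_integral_suminf) (simp_all add: nn_integral_cmult \<phi>[OF that])
    also have "\<dots> = (\<Sum>n. ennreal (c n * x ^ n))"
      using c that by (simp add: ennreal_mult)
    also have "\<dots> = ennreal (f x)"
      using c that nonneg_power_seriesD[OF assms]
      by (subst suminf_ennreal2) auto
    finally show ?thesis .
  qed
  have "sets \<tau> = sets borel" by (simp add: \<tau>_def)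
  moreover have "emeasure \<tau> {..<0} = 0"
  proof -
    have "max (0 :: real) -` {..<0} \<inter> space (density lborel \<rho>) = {}" by auto
    thus ?thesis by (simp add: \<tau>_def emeasure_distr)
  qed
  moreover have "has_bochner_integral \<tau> (\<lambda>t. indicator {0..} t *\<^sub>R exp (- t / x)) (f x)" if "x > 0" for x
    using int[OF that] nonneg_power_series_nonneg[OF assms, of x] that
    by (intro has_bochner_integral_nn_integral) (auto simp: \<tau>_def)
  ultimately show ?thesis
    by (intro exI[of _ \<tau>])
       (auto simp: set_integrable_def set_lebesgue_integral_def has_bochner_integral_iff)
qed

section \<open>Coefficients of Turan determinants\<close>

lemma pochhammer_nonneg_real: "x \<ge> 0 \<Longrightarrow> pochhammer (x :: real) n \<ge> 0"
  by (cases "x = 0") (auto simp: pochhammer_0_left intro: pochhammer_nonneg)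

lemma pochhammer_strict_mono_nonneg:
  fixes x y :: real
  assumes "0 \<le> x" "x < y" "n > 0"
  shows "pochhammer x n < pochhammer y n"
  using assms(3)
proof (induction n rule: nat_induct_non_zero)
  case (Suc n)
  have "pochhammer x n * (x + real n) < pochhammer y n * (y + real n)"
    using Suc assms(1,2) by (intro mult_strict_mono pochhammer_pos) (auto intro: pochhammer_nonneg_real)
  thus ?case by (simp add: pochhammer_Suc)
qed (use assms in auto)

text \<open>Since \<open>x \<ge> -1\<close>, at most the first factor of
  \<open>pochhammer x n\<close> is negative, and splitting it off leaves nonnegative symbols. The
  last hypothesis excludes \<open>x = -1\<close>, \<open>y = 0\<close>, where both sides vanish once
  \<open>n \<ge> 2\<close>; this is the origin of the boundary cases below.\<close>

lemma pochhammer_strict_mono: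
  fixes x y :: real
  assumes "-1 \<le> x" "x < y" "0 \<le> y" "n > 0" "-1 < x \<or> 0 < y"
  shows "pochhammer x n < pochhammer y n"
proof (cases "x \<ge> 0")
  case True
  thus ?thesis using pochhammer_strict_mono_nonneg assms by blast
next
  case x: False
  obtain m where n: "n = Suc m" using assms(4) by (cases n) auto
  have rec: "pochhammer z n = z * pochhammer (z + 1) m" for z :: real
    by (simp add: n pochhammer_rec)
  have "pochhammer (x + 1) m \<ge> 0" "pochhammer (y + 1) m > 0"
    using assms by (auto intro: pochhammer_nonneg_real pochhammer_pos)
  moreover have "pochhammer (x + 1) m > 0" if "-1 < x"
    using that by (intro pochhammer_pos) simp
  ultimately show ?thesis
    unfolding rec using x assms(3,5)
    by (smt (verit) mult_nonneg_nonneg mult_neg_pos mult_pos_pos mult_nonpos_nonneg)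
qed

lemma pochhammer_mono:
  fixes x y :: real
  assumes "-1 \<le> x" "x < y" "0 \<le> y"
  shows "pochhammer x n \<le> pochhammer y n"
proof (cases "n > 0 \<and> (-1 < x \<or> 0 < y)")
  case True
  thus ?thesis using pochhammer_strict_mono[of x y n] assms by auto
next
  case False
  have "pochhammer (-1 :: real) n \<le> pochhammer 0 n"
    by (cases n) (auto simp: pochhammer_rec pochhammer_nonneg_real)
  thus ?thesis using False assms by force
qed

lemma rGamma_pos: "x > 0 \<Longrightarrow> rGamma (x :: real) > 0"
  by (simp add: rGamma_inverse_Gamma)

lemma rGamma_nonneg: "x \<ge> 0 \<Longrightarrow> rGamma (x :: real) \<ge> 0"
  by (cases "x = 0") (auto simp: less_imp_le rGamma_pos)

text \<open>Each unshifted value is the shifted one times a Pochhammer symbol. The sign of a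
  determinant of gamma values is thereby reduced to comparing two Pochhammer symbols.\<close>

lemma rGamma_cross_diff:
  fixes u v :: real
  shows "rGamma (u + real d) * rGamma v - rGamma u * rGamma (v + real d) =
    rGamma (u + real d) * rGamma (v + real d) * (pochhammer v d - pochhammer u d)"
  using pochhammer_rGamma[of u d] pochhammer_rGamma[of v d] by (simp add: algebra_simps)

text \<open>Abel summation, followed by averaging with the reflected sum.\<close>
lemma symmetric_abel_summation:
  fixes w T :: "nat \<Rightarrow> real"
  assumes sym: "\<And>k. k \<le> m \<Longrightarrow> w (m - k) = w k"
  defines "v \<equiv> \<lambda>k. (if k \<le> m then w k else 0) - (if k = 0 then 0 else w (k - 1))"
  shows "2 * (\<Sum>k\<le>m. w k * (T (Suc k) - T k)) = (\<Sum>k\<le>Suc m. v k * (T (Suc m - k) - T k))"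
proof -
  \<comment> \<open>\<open>v\<close> is the difference sequence of \<open>w\<close> extended by zero
    outside \<open>{..m}\<close>, so no boundary terms remain.\<close>
  have "(\<Sum>k\<le>m. w k * T (Suc k)) = (\<Sum>k\<le>Suc m. (if k = 0 then 0 else w (k - 1)) * T k)"
    by (subst sum.atMost_Suc_shift) simp
  moreover have "(\<Sum>k\<le>m. w k * T k) = (\<Sum>k\<le>Suc m. (if k \<le> m then w k else 0) * T k)"
    by simp
  ultimately have S: "(\<Sum>k\<le>m. w k * (T (Suc k) - T k)) = - (\<Sum>k\<le>Suc m. v k * T k)"
    unfolding v_def by (simp only: left_diff_distrib right_diff_distrib sum_subtractf)
  have anti: "v (Suc m - k) = - v k" if "k \<le> Suc m" for k
  proof -
    have "w (m - k) = w k" if "k \<le> m" using sym that by simp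
    moreover have "w (Suc m - k) = w (k - 1)" if "0 < k"
      using sym[of "k - 1"] that \<open>k \<le> Suc m\<close> by simp
    ultimately show ?thesis
      using that unfolding v_def by (cases "k = 0"; cases "k = Suc m") auto
  qed
  have "(\<Sum>k\<le>Suc m. v k * T (Suc m - k)) = (\<Sum>k\<le>Suc m. v (Suc m - k) * T k)"
    by (rule sum.reindex_bij_witness[where i = "\<lambda>k. Suc m - k" and j = "\<lambda>k. Suc m - k"]) auto
  also have "\<dots> = - (\<Sum>k\<le>Suc m. v k * T k)"
    using anti by (simp flip: sum_negf)
  finally show ?thesis
    using S by (simp only: right_diff_distrib sum_subtractf)
qed

text \<open>\<open>log_concave\<close> says that the ratios \<open>h (Suc k) / h k\<close> do not
  increase, multiplied out for arbitrary \<open>k \<le> l\<close>.\<close>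

locale log_concave_seq =
  fixes h :: "nat \<Rightarrow> real"
  assumes pos: "h n > 0"
    and log_concave: "k \<le> l \<Longrightarrow> h k * h (Suc l) \<le> h (Suc k) * h l"
begin

definition turan_coeff :: "real \<Rightarrow> real \<Rightarrow> nat \<Rightarrow> real" where
  "turan_coeff \<beta> \<mu> m = (\<Sum>k\<le>m. h k * h (m - k) *
     (rGamma (\<mu> + 1 + real k) * rGamma (\<mu> + \<beta> + real (m - k))
      - rGamma (\<mu> + real k) * rGamma (\<mu> + \<beta> + 1 + real (m - k))))"

text \<open>Summand of the reflected Abel sum. The conditionals put the weights to zero outside
  \<open>{..m}\<close>, where truncated subtraction would give nonzero values.\<close>

definition cross_term :: "real \<Rightarrow> real \<Rightarrow> nat \<Rightarrow> nat \<Rightarrow> real" where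
  "cross_term \<beta> \<mu> m k =
     ((if k \<le> m then h k * h (m - k) else 0) - (if k = 0 then 0 else h (k - 1) * h (m - (k - 1)))) *
     (rGamma (\<mu> + real (Suc m - k)) * rGamma (\<mu> + \<beta> + real k)
      - rGamma (\<mu> + real k) * rGamma (\<mu> + \<beta> + real (Suc m - k)))"

lemma turan_coeff_eq: "2 * turan_coeff \<beta> \<mu> m = (\<Sum>k\<le>Suc m. cross_term \<beta> \<mu> m k)"
proof -
  define T where "T = (\<lambda>k. rGamma (\<mu> + real k) * rGamma (\<mu> + \<beta> + real (Suc m - k)))"
  have "turan_coeff \<beta> \<mu> m = (\<Sum>k\<le>m. h k * h (m - k) * (T (Suc k) - T k))"
    unfolding turan_coeff_def T_def by (intro sum.cong refl) (auto simp: Suc_diff_le add_ac)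
  also have "2 * \<dots> = (\<Sum>k\<le>Suc m. cross_term \<beta> \<mu> m k)"
    by (subst symmetric_abel_summation)
       (auto simp: T_def cross_term_def mult_ac intro!: sum.cong)
  finally show ?thesis .
qed

text \<open>Both factors change sign under the reflection, so signs need checking only below the
  midpoint.\<close>

lemma cross_term_reflect:
  assumes "k \<le> Suc m"
  shows "cross_term \<beta> \<mu> m (Suc m - k) = cross_term \<beta> \<mu> m k"
proof -
  consider "k = 0" | "k = Suc m" | j where "k = Suc j" "j < m"
    using assms by (cases k) (auto simp: le_less)
  thus ?thesis
    by cases (auto simp: cross_term_def Suc_diff_Suc algebra_simps of_nat_diff)
qed

text \<open>Here \<open>d\<close> is the distance from \<open>k\<close> to its mirror image
  \<open>Suc m - k\<close>, which is the shift in \<open>rGamma_cross_diff\<close>.\<close>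

lemma cross_term_eq:
  assumes "k + (k + d) = Suc m"
  shows "cross_term \<beta> \<mu> m k =
    ((if k \<le> m then h k * h (m - k) else 0) - (if k = 0 then 0 else h (k - 1) * h (m - (k - 1)))) *
     (rGamma (\<mu> + real (k + d)) * rGamma (\<mu> + \<beta> + real (k + d)) *
       (pochhammer (\<mu> + \<beta> + real k) d - pochhammer (\<mu> + real k) d))"
proof -
  have "Suc m - k = k + d" using assms by simp
  thus ?thesis
    using rGamma_cross_diff[of "\<mu> + real k" d "\<mu> + \<beta> + real k"]
    by (simp add: cross_term_def add_ac)
qed

lemma weight_mono:
  assumes "0 < k" "k \<le> m - k"
  shows "h (k - 1) * h (m - (k - 1)) \<le> h k * h (m - k)"
  using log_concave[of "k - 1" "m - k"] assms by (cases k) (auto simp: Suc_diff_Suc)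

lemma cross_term_nonneg:
  assumes "\<mu> \<ge> -1" "\<beta> > 0" "\<mu> + \<beta> \<ge> 0" "k \<le> Suc m"
  shows "cross_term \<beta> \<mu> m k \<ge> 0"
proof -
  have *: "cross_term \<beta> \<mu> m k \<ge> 0" if "k + (k + d) = Suc m" "d > 0" for k d
  proof -
    have "(if k \<le> m then h k * h (m - k) else 0) - (if k = 0 then 0 else h (k - 1) * h (m - (k - 1))) \<ge> 0"
      using weight_mono[of k m] pos that by (auto simp: less_imp_le)
    moreover have "pochhammer (\<mu> + real k) d \<le> pochhammer (\<mu> + \<beta> + real k) d"
      using assms by (intro pochhammer_mono) auto
    \<comment> \<open>\<open>d \<ge> 1\<close> lifts the argument from \<open>\<mu> \<ge> -1\<close>
      to a nonnegative one.\<close>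
    moreover have "rGamma (\<mu> + real (k + d)) \<ge> 0" "rGamma (\<mu> + \<beta> + real (k + d)) \<ge> 0"
      using assms that by (auto intro!: rGamma_nonneg)
    ultimately show ?thesis
      unfolding cross_term_eq[OF that(1)] by (intro mult_nonneg_nonneg) auto
  qed
  consider "k < Suc m - k" | "k = Suc m - k" | "Suc m - k < k" by linarith
  thus ?thesis
  proof cases
    case 1
    thus ?thesis using *[of k "Suc m - k - k"] by simp
  next
    case 2
    thus ?thesis by (simp add: cross_term_def)
  next
    case 3
    thus ?thesis
      using *[of "Suc m - k" "k - (Suc m - k)"] cross_term_reflect[OF assms(4)] assms(4) by simp
  qed
qed

lemma turan_coeff_pos_if:
  assumes "\<mu> \<ge> -1" "\<beta> > 0" "\<mu> + \<beta> \<ge> 0" "k \<le> Suc m" "cross_term \<beta> \<mu> m k > 0"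
  shows "turan_coeff \<beta> \<mu> m > 0"
proof -
  have "(\<Sum>k\<le>Suc m. cross_term \<beta> \<mu> m k) > 0"
    using assms cross_term_nonneg[OF assms(1-3)] by (intro sum_pos2[of _ k]) auto
  thus ?thesis using turan_coeff_eq[of \<beta> \<mu> m] by simp
qed

lemma turan_coeff_nonneg:
  assumes "\<mu> \<ge> -1" "\<beta> > 0" "\<mu> + \<beta> \<ge> 0"
  shows "turan_coeff \<beta> \<mu> m \<ge> 0"
proof -
  have "(\<Sum>k\<le>Suc m. cross_term \<beta> \<mu> m k) \<ge> 0"
    using cross_term_nonneg[OF assms] by (intro sum_nonneg) auto
  thus ?thesis using turan_coeff_eq[of \<beta> \<mu> m] by simp
qed

text \<open>The term \<open>k = 0\<close> suffices: its weight factor is \<open>h 0 * h m\<close>,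
  and the Pochhammer comparison is strict. At \<open>\<mu> = -1\<close> the case
  \<open>m = 0\<close> is excluded because there \<open>rGamma (\<mu> + 1) = 0\<close>.\<close>

lemma turan_coeff_pos:
  assumes "\<mu> \<ge> -1" "\<beta> > 0" "\<mu> + \<beta> \<ge> 0" "\<mu> > -1 \<or> \<mu> + \<beta> > 0 \<and> m > 0"
  shows "turan_coeff \<beta> \<mu> m > 0"
proof (rule turan_coeff_pos_if[OF assms(1-3), of 0])
  have "pochhammer \<mu> (Suc m) < pochhammer (\<mu> + \<beta>) (Suc m)"
    using assms by (intro pochhammer_strict_mono) auto
  moreover have "rGamma (\<mu> + real (Suc m)) > 0" "rGamma (\<mu> + \<beta> + real (Suc m)) > 0"
    using assms by (auto intro!: rGamma_pos)
  ultimately show "cross_term \<beta> \<mu> m 0 > 0"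
    using pos by (subst cross_term_eq[of _ "Suc m"]) (auto simp del: of_nat_Suc)
qed auto

text \<open>At this corner both Pochhammer symbols of the term \<open>k = 0\<close> vanish. The term
  \<open>k = 1\<close> takes over, with a weight factor that is positive by the strict inequality
  assumed.\<close>

lemma turan_coeff_pos_boundary:
  assumes "h 0 * h m < h 1 * h (m - 1)" "m \<ge> 2"
  shows "turan_coeff 1 (-1) m > 0"
proof (rule turan_coeff_pos_if[of _ _ 1])
  have "pochhammer (0 :: real) (m - 1) < pochhammer 1 (m - 1)"
    using assms by (intro pochhammer_strict_mono) auto
  moreover have "rGamma (real (m - 1)) > 0" "rGamma (real m) > 0"
    using assms by (auto intro!: rGamma_pos)
  ultimately show "cross_term 1 (-1) m 1 > 0"
    using assms by (subst cross_term_eq[of _ "m - 1"]) (auto simp: of_nat_diff)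
qed auto

lemma turan_coeff_0: "turan_coeff \<beta> \<mu> 0 = (h 0)\<^sup>2 * (\<beta> * rGamma (\<mu> + 1) * rGamma (\<mu> + \<beta> + 1))"
proof -
  have "rGamma \<mu> = \<mu> * rGamma (\<mu> + 1)" "rGamma (\<mu> + \<beta>) = (\<mu> + \<beta>) * rGamma (\<mu> + \<beta> + 1)"
    by (simp_all add: rGamma_plus1)
  thus ?thesis
    unfolding turan_coeff_def by (simp add: power2_eq_square) (simp add: algebra_simps)
qed

text \<open>Coefficient of \<open>x ^ m\<close> in the lower bound of the ratio after clearing
  denominators.\<close>

definition ratio_coeff :: "real \<Rightarrow> real \<Rightarrow> nat \<Rightarrow> real" where
  "ratio_coeff \<beta> \<mu> m = (\<Sum>k\<le>m. h k * h (m - k) *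
     ((\<mu> + \<beta>) * (rGamma (\<mu> + real k) * rGamma (\<mu> + \<beta> + 1 + real (m - k)))
      - \<mu> * (rGamma (\<mu> + 1 + real k) * rGamma (\<mu> + \<beta> + real (m - k)))))"

lemma ratio_coeff_0: "ratio_coeff \<beta> \<mu> 0 = 0"
proof -
  have "rGamma \<mu> = \<mu> * rGamma (\<mu> + 1)" "rGamma (\<mu> + \<beta>) = (\<mu> + \<beta>) * rGamma (\<mu> + \<beta> + 1)"
    by (simp_all add: rGamma_plus1)
  thus ?thesis
    unfolding ratio_coeff_def by simp
qed

text \<open>Extracting \<open>rGamma z = z * rGamma (z + 1)\<close> cancels the products
  \<open>\<mu> * (\<mu> + \<beta>)\<close> and leaves the factor
  \<open>(\<mu> + \<beta>) * i - \<mu> * j\<close>, which may be negative. The weights are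
  symmetric, so \<open>(i, j)\<close> is paired with \<open>(j, i)\<close>: the sum is
  \<open>P * X + Q * Y\<close> with \<open>0 \<le> P \<le> Q\<close>, \<open>Q > 0\<close>,
  \<open>Y > 0\<close> and \<open>X + Y > 0\<close>.\<close>

lemma ratio_coeff_pos:
  assumes "\<mu> \<ge> -1" "\<beta> > 0" "\<mu> + \<beta> > 0" "m > 0"
  shows "ratio_coeff \<beta> \<mu> m > 0"
proof -
  define F where "F = (\<lambda>i j. rGamma (\<mu> + 1 + real i) * rGamma (\<mu> + \<beta> + 1 + real j) *
    ((\<mu> + \<beta>) * real i - \<mu> * real j))"
  have F: "(\<mu> + \<beta>) * (rGamma (\<mu> + real i) * rGamma (\<mu> + \<beta> + 1 + real j))
      - \<mu> * (rGamma (\<mu> + 1 + real i) * rGamma (\<mu> + \<beta> + real j)) = F i j" for i j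
  proof -
    have "rGamma (\<mu> + real i) = (\<mu> + real i) * rGamma (\<mu> + 1 + real i)"
         "rGamma (\<mu> + \<beta> + real j) = (\<mu> + \<beta> + real j) * rGamma (\<mu> + \<beta> + 1 + real j)"
      using rGamma_plus1[of "\<mu> + real i"] rGamma_plus1[of "\<mu> + \<beta> + real j"]
      by (metis add.assoc add.commute)+
    thus ?thesis unfolding F_def by (simp add: algebra_simps)
  qed
  have *: "F i j + F j i > 0" if "i \<le> j" "i + j > 0" for i j
  proof -
    define P where "P = rGamma (\<mu> + 1 + real i) * rGamma (\<mu> + \<beta> + 1 + real j)"
    define Q where "Q = rGamma (\<mu> + 1 + real j) * rGamma (\<mu> + \<beta> + 1 + real i)"
    define X where "X = (\<mu> + \<beta>) * real i - \<mu> * real j"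
    define Y where "Y = (\<mu> + \<beta>) * real j - \<mu> * real i"
    have j: "j > 0" using that by auto
    have shift: "z + real i + real (j - i) = z + real j" for z :: real
      using that by simp
    have "Q - P = rGamma (\<mu> + 1 + real j) * rGamma (\<mu> + \<beta> + 1 + real j) *
        (pochhammer (\<mu> + \<beta> + 1 + real i) (j - i) - pochhammer (\<mu> + 1 + real i) (j - i))"
      using rGamma_cross_diff[of "\<mu> + 1 + real i" "j - i" "\<mu> + \<beta> + 1 + real i"]
      by (simp only: P_def Q_def shift)
    also have "\<dots> \<ge> 0"
      using pochhammer_mono[of "\<mu> + 1 + real i" "\<mu> + \<beta> + 1 + real i" "j - i"] assms j
      by (intro mult_nonneg_nonneg rGamma_nonneg) auto
    finally have "P \<le> Q" by simp
    have "P \<ge> 0" "Q > 0"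
      unfolding P_def Q_def using assms j by (auto intro!: mult_nonneg_nonneg mult_pos_pos rGamma_nonneg rGamma_pos)
    have XY: "X + Y > 0"
    proof -
      have "X + Y = \<beta> * (real i + real j)" by (simp add: X_def Y_def algebra_simps)
      thus ?thesis using assms j by simp
    qed
    have Y: "Y > 0"
    proof (cases "\<mu> \<ge> 0")
      case True
      have "\<mu> * real i \<le> \<mu> * real j" using True that by (intro mult_left_mono) auto
      moreover have "\<beta> * real j > 0" using assms j by simp
      ultimately show ?thesis by (simp add: Y_def algebra_simps)
    next
      case False
      have "\<mu> * real i \<le> 0" using False by (simp add: mult_nonpos_nonneg)
      moreover have "(\<mu> + \<beta>) * real j > 0" using assms j by simp
      ultimately show ?thesis by (simp add: Y_def)
    qed
    have "P * X + Q * Y > 0"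
    proof (cases "X \<ge> 0")
      case True
      thus ?thesis using \<open>P \<ge> 0\<close> \<open>Q > 0\<close> Y by (simp add: add_nonneg_pos)
    next
      case False
      \<comment> \<open>For negative \<open>X\<close>, replacing \<open>P\<close> by the larger
        \<open>Q\<close> only decreases the sum.\<close>
      have "Q * (X + Y) > 0" using XY \<open>Q > 0\<close> by simp
      moreover have "Q * X \<le> P * X" using False \<open>P \<le> Q\<close> by (intro mult_right_mono_neg) auto
      ultimately show ?thesis by (simp add: algebra_simps)
    qed
    thus ?thesis by (simp add: F_def P_def Q_def X_def Y_def mult_ac)
  qed
  have ratio: "ratio_coeff \<beta> \<mu> m = (\<Sum>k\<le>m. h k * h (m - k) * F k (m - k))"
    unfolding ratio_coeff_def F ..
  also have "\<dots> = (\<Sum>k\<le>m. h k * h (m - k) * F (m - k) k)"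
    by (rule sum.reindex_bij_witness[where i = "\<lambda>k. m - k" and j = "\<lambda>k. m - k"]) auto
  finally have "2 * ratio_coeff \<beta> \<mu> m = (\<Sum>k\<le>m. h k * h (m - k) * (F k (m - k) + F (m - k) k))"
    using ratio by (simp add: sum.distrib distrib_left)
  also have "\<dots> > 0"
  proof (rule sum_pos)
    fix k assume "k \<in> {..m}"
    hence "F k (m - k) + F (m - k) k > 0"
      using *[of k "m - k"] *[of "m - k" k] assms(4) by (cases "k \<le> m - k") auto
    thus "h k * h (m - k) * (F k (m - k) + F (m - k) k) > 0" using pos by simp
  qed auto
  finally show ?thesis by simp
qed

end

section \<open>The normalised hypergeometric function\<close>

text \<open>At \<open>j = 0\<close> the right-hand denominator in \<open>chain\<close> is
  \<open>elem_sym 0 as = 1\<close>, which is the right end of the chain.\<close>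

locale hyper_params =
  fixes as bs :: "real list"
  assumes length_le: "length as \<le> Suc (length bs)"
    and as_pos: "\<forall>a\<in>set as. a > 0" and bs_pos: "\<forall>b\<in>set bs. b > 0"
    and chain: "\<And>j. j < length as \<Longrightarrow>
      elem_sym (Suc (length bs) - length as + Suc j) (1 # bs) / elem_sym (Suc j) as
      \<le> elem_sym (Suc (length bs) - length as + j) (1 # bs) / elem_sym j as"
begin

abbreviation h :: "nat \<Rightarrow> real" where "h \<equiv> hyper_coeff as bs"

definition num :: "real \<Rightarrow> real" where "num t = (\<Prod>a\<leftarrow>as. a + t)"

text \<open>The extra entry \<open>1\<close> is the factor \<open>n + 1\<close> contributed by
  \<open>fact\<close>.\<close>

definition den :: "real \<Rightarrow> real" where "den t = (\<Prod>b\<leftarrow>1 # bs. b + t)"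

lemma prod_list_add_pos:
  fixes xs :: "real list"
  shows "\<forall>a\<in>set xs. a > 0 \<Longrightarrow> t \<ge> 0 \<Longrightarrow> (\<Prod>a\<leftarrow>xs. a + t) > 0"
  by (induction xs) (auto intro!: mult_pos_pos add_pos_nonneg)

lemma num_pos: "t \<ge> 0 \<Longrightarrow> num t > 0"
  and den_pos: "t \<ge> 0 \<Longrightarrow> den t > 0"
  unfolding num_def den_def using as_pos bs_pos by (auto intro!: prod_list_add_pos mult_pos_pos)

lemma hyper_coeff_Suc: "h (Suc n) = h n * num (real n) / den (real n)"
proof -
  have "(\<Prod>a\<leftarrow>xs. pochhammer a (Suc n)) = (\<Prod>a\<leftarrow>xs. pochhammer a n) * (\<Prod>a\<leftarrow>xs. a + real n)"
    for xs :: "real list"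
    by (induction xs) (simp_all add: pochhammer_Suc)
  thus ?thesis by (simp add: hyper_coeff_def num_def den_def add_ac mult_ac)
qed

lemma hyper_coeff_0 [simp]: "h 0 = 1"
proof -
  have "(\<Prod>a\<leftarrow>xs. pochhammer a 0) = 1" for xs :: "real list"
    by (induction xs) simp_all
  thus ?thesis by (simp add: hyper_coeff_def)
qed

lemma hyper_coeff_pos: "h n > 0"
  by (induction n) (auto simp: hyper_coeff_Suc intro!: divide_pos_pos mult_pos_pos num_pos den_pos)

text \<open>Both products are expanded in elementary symmetric polynomials; the chain says that the
  quotients \<open>f\<close> of their coefficients do not increase, which is the hypothesis of
  \<open>cross_product_mono\<close>.\<close>

lemma num_den_cross:
  assumes "0 \<le> x" "x < y"
  shows "den x * num y \<le> den y * num x"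
    and "mset as \<noteq> mset (1 # bs) \<Longrightarrow> den x * num y < den y * num x"
proof -
  define p where "p = length as"
  define N where "N = Suc (length bs)"
  define r where "r = N - p"
  \<comment> \<open>The coefficients of \<open>num\<close> are padded with \<open>r\<close> leading
    zeros to match the degree \<open>N\<close> of \<open>den\<close>.\<close>
  define \<alpha> where "\<alpha> = (\<lambda>i. if i < r then 0 else elem_sym (i - r) as)"
  define \<beta> where "\<beta> = (\<lambda>i. elem_sym i (1 # bs))"
  define f where "f = (\<lambda>j. \<beta> (r + j) / \<alpha> (r + j))"
  have N: "N = r + p" using length_le by (simp add: N_def r_def p_def)
  have den: "den t = (\<Sum>i\<le>N. \<beta> i * t ^ (N - i))" for t
    unfolding den_def prod_list_add_eq_elem_sym by (simp add: \<beta>_def N_def)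
  have num: "num t = (\<Sum>i\<le>N. \<alpha> i * t ^ (N - i))" for t
  proof -
    have "(\<Sum>i\<le>N. \<alpha> i * t ^ (N - i)) = (\<Sum>i\<in>{r..r+p}. \<alpha> i * t ^ (N - i))"
      by (rule sum.mono_neutral_right) (auto simp: \<alpha>_def N)
    also have "\<dots> = (\<Sum>j\<le>p. elem_sym j as * t ^ (p - j))"
      by (rule sum.reindex_bij_witness[where i = "\<lambda>j. r + j" and j = "\<lambda>i. i - r"])
         (auto simp: \<alpha>_def N add.commute)
    finally show ?thesis
      unfolding num_def prod_list_add_eq_elem_sym by (simp add: p_def)
  qed
  have \<alpha>_pos: "\<alpha> (r + j) > 0" if "j \<le> p" for j
    using that as_pos by (auto simp: \<alpha>_def p_def intro!: elem_sym_pos)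
  have \<beta>_pos: "\<beta> i > 0" if "i \<le> N" for i
    unfolding \<beta>_def using that bs_pos by (intro elem_sym_pos) (auto simp: N_def)
  have f_Suc: "f (Suc j) \<le> f j" if "j < p" for j
    using chain[of j] that by (simp add: f_def \<alpha>_def \<beta>_def r_def N_def p_def)
  have f_mono: "f k \<le> f j" if "j \<le> k" "k \<le> p" for j k
    using that by (induction k rule: dec_induct) (auto intro: order_trans[OF f_Suc])
  have cross: "\<beta> l * \<alpha> i \<le> \<beta> i * \<alpha> l" if "i < l" "l \<le> N" for i l
  proof (cases "i < r")
    case True
    have "\<alpha> l \<ge> 0"
      using \<alpha>_pos[of "l - r"] that by (cases "l < r") (auto simp: N \<alpha>_def le_diff_conv less_imp_le)
    thus ?thesis using True \<beta>_pos[of i] that by (simp add: \<alpha>_def)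
  next
    case False
    define j k where "j = i - r" and "k = l - r"
    have jk: "i = r + j" "l = r + k" "j \<le> k" "k \<le> p"
      using False that by (auto simp: j_def k_def N)
    thus ?thesis
      using f_mono[of j k] \<alpha>_pos[of j] \<alpha>_pos[of k] by (simp add: f_def field_simps)
  qed
  note mono = cross_product_mono[where N = N and \<alpha> = \<alpha> and \<beta> = \<beta>, OF cross assms]
  show "den x * num y \<le> den y * num x"
    using mono(1) by (simp only: num den)
  assume ne: "mset as \<noteq> mset (1 # bs)"
  \<comment> \<open>Otherwise \<open>\<alpha> 0\<close> is nonzero, so \<open>r = 0\<close>, and
    \<open>f p \<ge> 1 = f 0\<close>. As \<open>f\<close> does not increase, it is constantly 1 and
    the two polynomials coincide.\<close>
  have "\<beta> N * \<alpha> 0 < \<beta> 0 * \<alpha> N"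
  proof (rule ccontr)
    assume "\<not> ?thesis"
    hence le: "\<alpha> N \<le> \<beta> N * \<alpha> 0" by (simp add: \<beta>_def)
    have r: "r = 0"
    proof (rule ccontr)
      assume "r \<noteq> 0"
      thus False using le \<alpha>_pos[of p] by (simp add: \<alpha>_def N)
    qed
    have "\<alpha> 0 = 1" "\<beta> 0 = 1" by (simp_all add: \<alpha>_def \<beta>_def r)
    hence "f 0 = 1" "f p \<ge> 1"
      using le \<alpha>_pos[of p] by (simp_all add: f_def r N)
    hence "f i = 1" if "i \<le> p" for i
      using f_mono[of 0 i] f_mono[of i p] that by simp
    hence "\<alpha> i = \<beta> i" if "i \<le> N" for i
      using that \<alpha>_pos[of i] by (simp add: f_def r N)
    hence "num t = den t" for t
      unfolding num den by (intro sum.cong) auto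
    hence "mset as = mset (1 # bs)"
      unfolding num_def den_def by (rule mset_eq_if_prod_list_add_eq)
    thus False using ne by simp
  qed
  moreover have "N > 0" by (simp add: N_def)
  ultimately show "den x * num y < den y * num x"
    using mono(2) by (simp only: num den)
qed

lemma hyper_coeff_log_concave:
  assumes "k \<le> l"
  shows "h k * h (Suc l) \<le> h (Suc k) * h l"
    and "k < l \<Longrightarrow> mset as \<noteq> mset (1 # bs) \<Longrightarrow> h k * h (Suc l) < h (Suc k) * h l"
proof -
  have "num l / den l \<le> num k / den k"
    using num_den_cross(1)[of k l] assms den_pos[of k] den_pos[of l]
    by (cases "k = l") (auto simp: field_simps)
  from mult_left_mono[OF this, of "h k * h l"] show "h k * h (Suc l) \<le> h (Suc k) * h l"
    using hyper_coeff_pos[of k] hyper_coeff_pos[of l] by (simp add: hyper_coeff_Suc mult_ac)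
  assume "k < l" "mset as \<noteq> mset (1 # bs)"
  hence "num l / den l < num k / den k"
    using num_den_cross(2)[of k l] den_pos[of k] den_pos[of l] by (auto simp: field_simps)
  from mult_strict_left_mono[OF this, of "h k * h l"] show "h k * h (Suc l) < h (Suc k) * h l"
    using hyper_coeff_pos[of k] hyper_coeff_pos[of l] by (simp add: hyper_coeff_Suc mult_ac)
qed

sublocale log_concave_seq h
  by unfold_locales (auto intro: hyper_coeff_pos hyper_coeff_log_concave)

section \<open>Power series of the function, of its determinants and of the ratio bound\<close>

abbreviation g :: "real \<Rightarrow> real \<Rightarrow> real" where "g \<equiv> g_hyper as bs"

lemma summable_g: "summable (\<lambda>n. h n * rGamma (\<nu> + real n) * x ^ n)"
  using summable_g_hyper[of as bs x \<nu>] length_le bs_pos by (simp add: mult_ac)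

lemma g_eq: "g \<nu> x = (\<Sum>n. h n * rGamma (\<nu> + real n) * x ^ n)"
  by (simp add: g_hyper_def mult_ac)

lemma g_mult_sums:
  "(\<lambda>m. (\<Sum>k\<le>m. h k * h (m - k) * (rGamma (\<mu> + real k) * rGamma (\<nu> + real (m - k)))) * x ^ m)
    sums (g \<mu> x * g \<nu> x)"
proof -
  define a where "a = (\<lambda>\<nu> n. h n * rGamma (\<nu> + real n) * x ^ n)"
  have "summable (\<lambda>n. norm (a \<nu> n))" for \<nu>
    \<comment> \<open>Absolute convergence at \<open>x\<close> comes from convergence at the larger
      point \<open>\<bar>x\<bar> + 1\<close>.\<close>
    unfolding a_def by (rule powser_insidea[OF summable_g[of \<nu> "\<bar>x\<bar> + 1"]]) simp
  hence "(\<lambda>m. \<Sum>k\<le>m. a \<mu> k * a \<nu> (m - k)) sums (g \<mu> x * g \<nu> x)"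
    using Cauchy_product_sums[of "a \<mu>" "a \<nu>"] by (simp add: g_eq a_def)
  also have "(\<lambda>m. \<Sum>k\<le>m. a \<mu> k * a \<nu> (m - k)) =
    (\<lambda>m. (\<Sum>k\<le>m. h k * h (m - k) * (rGamma (\<mu> + real k) * rGamma (\<nu> + real (m - k)))) * x ^ m)"
    unfolding sum_distrib_right
  proof (intro ext sum.cong refl)
    fix m k :: nat assume "k \<in> {..m}"
    hence "x ^ m = x ^ k * x ^ (m - k)" by (simp flip: power_add)
    thus "a \<mu> k * a \<nu> (m - k) =
      h k * h (m - k) * (rGamma (\<mu> + real k) * rGamma (\<nu> + real (m - k))) * x ^ m"
      by (simp add: a_def mult_ac)
  qed
  finally show ?thesis .
qed

lemma g_power_series:
  assumes "\<nu> \<ge> 0"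
  shows "nonneg_power_series (\<lambda>n. h n * rGamma (\<nu> + real n)) (g \<nu>)"
  unfolding nonneg_power_series_def g_eq
  using assms by (auto intro!: summable_sums summable_g mult_nonneg_nonneg rGamma_nonneg less_imp_le[OF pos])

lemma g_pos:
  assumes "\<nu> \<ge> 0" "x \<ge> 0" "\<nu> > 0 \<or> x > 0"
  shows "g \<nu> x > 0"
proof (cases "\<nu> > 0")
  case True
  thus ?thesis
    using nonneg_power_series_ge_partial[OF g_power_series, of \<nu> x "{0}"] rGamma_pos[of \<nu>] assms by simp
next
  case False
  \<comment> \<open>At \<open>\<nu> = 0\<close> the constant term vanishes; the term
    \<open>n = 1\<close> is positive.\<close>
  hence "x > 0" using assms(3) by simp
  moreover have "h 1 * rGamma (\<nu> + real 1) > 0"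
    using assms(1) by (intro mult_pos_pos pos rGamma_pos) simp
  ultimately show ?thesis
    by (rule nonneg_power_series_pos[OF g_power_series[OF assms(1)]])
qed

lemma lam_power_series:
  assumes "\<mu> \<ge> -1" "\<beta> > 0" "\<mu> + \<beta> \<ge> 0"
  shows "nonneg_power_series (turan_coeff \<beta> \<mu>) (lam_hyper as bs \<beta> \<mu>)"
proof -
  have "(\<lambda>m. turan_coeff \<beta> \<mu> m * x ^ m) sums lam_hyper as bs \<beta> \<mu> x" for x
    using sums_diff[OF g_mult_sums[of "\<mu> + 1" "\<mu> + \<beta>" x] g_mult_sums[of \<mu> "\<mu> + \<beta> + 1" x]]
    by (simp add: turan_coeff_def lam_hyper_def right_diff_distrib sum_subtractf left_diff_distrib)
  thus ?thesis
    using turan_coeff_nonneg[OF assms] by (simp add: nonneg_power_series_def)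
qed

lemma ratio_power_series:
  assumes "\<mu> \<ge> -1" "\<beta> > 0" "\<mu> + \<beta> > 0"
  shows "nonneg_power_series (ratio_coeff \<beta> \<mu>)
    (\<lambda>x. (\<mu> + \<beta>) * (g \<mu> x * g (\<mu> + \<beta> + 1) x) - \<mu> * (g (\<mu> + 1) x * g (\<mu> + \<beta>) x))"
proof -
  have "(\<lambda>m. ratio_coeff \<beta> \<mu> m * x ^ m) sums
    ((\<mu> + \<beta>) * (g \<mu> x * g (\<mu> + \<beta> + 1) x) - \<mu> * (g (\<mu> + 1) x * g (\<mu> + \<beta>) x))" for x
  proof -
    have *: "ratio_coeff \<beta> \<mu> m * x ^ m =
      (\<mu> + \<beta>) * ((\<Sum>k\<le>m. h k * h (m - k) * (rGamma (\<mu> + real k) * rGamma (\<mu> + \<beta> + 1 + real (m - k)))) * x ^ m)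
      - \<mu> * ((\<Sum>k\<le>m. h k * h (m - k) * (rGamma (\<mu> + 1 + real k) * rGamma (\<mu> + \<beta> + real (m - k)))) * x ^ m)" for m
      unfolding ratio_coeff_def sum_distrib_left sum_distrib_right sum_subtractf[symmetric]
      by (intro sum.cong refl) (simp only: right_diff_distrib left_diff_distrib mult_ac)
    show ?thesis
      unfolding * by (intro sums_diff sums_mult g_mult_sums)
  qed
  moreover have "ratio_coeff \<beta> \<mu> m \<ge> 0" for m
    using ratio_coeff_pos[OF assms, of m] ratio_coeff_0 by (cases "m = 0") auto
  ultimately show ?thesis by (simp add: nonneg_power_series_def)
qed

lemma lam_ge:
  assumes "\<mu> \<ge> -1" "\<beta> > 0" "\<mu> + \<beta> \<ge> 0" "x \<ge> 0"
  shows "\<beta> * rGamma (\<mu> + 1) * rGamma (\<mu> + \<beta> + 1) \<le> lam_hyper as bs \<beta> \<mu> x"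
  using nonneg_power_series_ge_partial[OF lam_power_series[OF assms(1-3)] assms(4), of "{0}"]
  by (simp add: turan_coeff_0)

lemma lam_0: "lam_hyper as bs \<beta> \<mu> 0 = \<beta> * rGamma (\<mu> + 1) * rGamma (\<mu> + \<beta> + 1)"
proof -
  have "g \<nu> 0 = rGamma \<nu>" for \<nu>
    unfolding g_eq by (subst powser_zero) simp
  thus ?thesis
    using turan_coeff_0[of \<beta> \<mu>] by (simp add: lam_hyper_def turan_coeff_def)
qed

text \<open>Only the corner \<open>\<mu> = -1\<close>, \<open>\<beta> = 1\<close> escapes
  \<open>turan_coeff_pos\<close>; there \<open>h\<close> is strictly log-concave because the two
  multisets differ. The coefficients with \<open>m \<le> 1\<close> vanish at that corner, hence
  \<open>m \<ge> 2\<close>.\<close>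

lemma turan_coeff_pos':
  assumes "\<mu> \<ge> -1" "\<beta> > 0" "\<mu> + \<beta> \<ge> 0" "m \<ge> 2"
    and "\<not> (\<mu> = -1 \<and> \<beta> = 1 \<and> mset as = mset (1 # bs))"
  shows "turan_coeff \<beta> \<mu> m > 0"
proof (cases "\<mu> > -1 \<or> \<mu> + \<beta> > 0")
  case True
  thus ?thesis using turan_coeff_pos assms by auto
next
  case False
  hence \<mu>: "\<mu> = -1" and \<beta>: "\<beta> = 1" using assms by auto
  have "h 0 * h m < h 1 * h (m - 1)"
    using hyper_coeff_log_concave(2)[of 0 "m - 1"] assms \<mu> \<beta> by simp
  thus ?thesis unfolding \<mu> \<beta> using assms(4) by (rule turan_coeff_pos_boundary)
qed

lemma lam_greater:
  assumes "\<mu> \<ge> -1" "\<beta> > 0" "\<mu> + \<beta> \<ge> 0" "x > 0"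
    and "\<not> (\<mu> = -1 \<and> \<beta> = 1 \<and> mset as = mset (1 # bs))"
  shows "\<beta> * rGamma (\<mu> + 1) * rGamma (\<mu> + \<beta> + 1) < lam_hyper as bs \<beta> \<mu> x"
proof -
  have "turan_coeff \<beta> \<mu> 2 * x\<^sup>2 > 0"
    using turan_coeff_pos'[OF assms(1-3) _ assms(5), of 2] assms(4) by simp
  thus ?thesis
    using nonneg_power_series_ge_partial[OF lam_power_series[OF assms(1-3)], of x "{0, 2}"] assms(4)
    by (simp add: turan_coeff_0)
qed

text \<open>Weierstrass M-test on a compact interval of positive parameters:
  \<open>rGamma (\<nu> + n) = rGamma \<nu> / pochhammer \<nu> n\<close>, and Pochhammer symbols grow
  with \<open>\<nu>\<close>, so the terms at the left end \<open>a\<close> dominate up to a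
  constant.\<close>

lemma continuous_on_g: "continuous_on {0<..} (\<lambda>\<nu>. g \<nu> x)"
proof (rule continuous_at_imp_continuous_on, intro ballI)
  fix \<nu>0 :: real assume "\<nu>0 \<in> {0<..}"
  define a where "a = \<nu>0 / 2"
  define b where "b = \<nu>0 + 1"
  have ab: "0 < a" "a < \<nu>0" "\<nu>0 < b" using \<open>\<nu>0 \<in> {0<..}\<close> by (auto simp: a_def b_def)
  have "compact (rGamma ` {a..b})"
    by (intro compact_continuous_image continuous_intros) auto
  then obtain K where K: "\<And>\<nu>. \<nu> \<in> {a..b} \<Longrightarrow> norm (rGamma \<nu>) \<le> K"
    by (meson bounded_iff compact_imp_bounded image_eqI)
  have bound: "norm (h n * rGamma (\<nu> + real n) * x ^ n) \<le>
      (K / rGamma a) * norm (h n * rGamma (a + real n) * x ^ n)" if \<nu>: "\<nu> \<in> {a..b}" for n \<nu>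
  proof -
    have poch: "0 < pochhammer a n" "pochhammer a n \<le> pochhammer \<nu> n"
      using ab \<nu> pochhammer_mono[of a \<nu> n] by (auto intro: pochhammer_pos simp: le_less)
    have "rGamma (\<nu> + real n) = rGamma \<nu> / pochhammer \<nu> n"
      using pochhammer_rGamma[of \<nu> n] poch by (simp add: field_simps)
    also have "\<dots> \<le> K / pochhammer a n"
      using K[OF \<nu>] poch rGamma_pos[of \<nu>] ab \<nu> by (intro frac_le) auto
    also have "\<dots> = (K / rGamma a) * rGamma (a + real n)"
      using pochhammer_rGamma[of a n] poch rGamma_pos[of "a + real n"] ab by (simp add: field_simps)
    finally have "rGamma (\<nu> + real n) \<le> (K / rGamma a) * rGamma (a + real n)" .
    moreover have "rGamma (\<nu> + real n) > 0" "rGamma (a + real n) > 0"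
      using ab \<nu> by (auto intro!: rGamma_pos)
    ultimately show ?thesis
      using mult_right_mono[of "rGamma (\<nu> + real n)" "(K / rGamma a) * rGamma (a + real n)" "\<bar>h n\<bar> * \<bar>x ^ n\<bar>"]
      by (simp add: abs_mult mult_ac)
  qed
  have "summable (\<lambda>n. (K / rGamma a) * norm (h n * rGamma (a + real n) * x ^ n))"
    by (intro summable_mult powser_insidea[OF summable_g[of a "\<bar>x\<bar> + 1"]]) simp
  with bound have "uniform_limit {a..b} (\<lambda>N \<nu>. \<Sum>n<N. h n * rGamma (\<nu> + real n) * x ^ n) (\<lambda>\<nu>. g \<nu> x) sequentially"
    unfolding g_eq by (rule Weierstrass_m_test)
  hence "continuous_on {a..b} (\<lambda>\<nu>. g \<nu> x)"
    by (rule uniform_limit_theorem[rotated])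
       (auto intro!: always_eventually continuous_intros continuous_on_compose2[OF continuous_on_rGamma])
  thus "isCont (\<lambda>\<nu>. g \<nu> x) \<nu>0"
    using ab by (intro continuous_on_interior[of "{a..b}"]) auto
qed

text \<open>A unit step is the positive lower bound of \<open>lam_hyper\<close>; longer integer
  steps follow by induction.\<close>

lemma g_strict_discrete_wright_log_concave:
  assumes "x \<ge> 0"
  shows "strict_discrete_wright_log_concave_on {0<..} (\<lambda>\<nu>. g \<nu> x)"
proof -
  have pos: "g \<nu> x > 0" if "\<nu> > 0" for \<nu>
    using that assms by (intro g_pos) auto
  have step: "g \<mu> x * g (\<mu> + s + 1) x < g (\<mu> + 1) x * g (\<mu> + s) x" if "\<mu> > 0" "s > 0" for \<mu> s
  proof -
    have "0 < s * rGamma (\<mu> + 1) * rGamma (\<mu> + s + 1)"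
      using that by (auto intro!: mult_pos_pos rGamma_pos)
    also have "\<dots> \<le> lam_hyper as bs s \<mu> x"
      using that assms by (intro lam_ge) auto
    finally show ?thesis by (simp add: lam_hyper_def)
  qed
  have "g \<mu> x * g (\<mu> + real k + s) x < g (\<mu> + real k) x * g (\<mu> + s) x"
    if "\<mu> > 0" "s > 0" "k > 0" for k \<mu> s
    using that(3)
  proof (induction k rule: nat_induct_non_zero)
    case 1
    show ?case using step[OF that(1,2)] by (simp add: add_ac)
  next
    case (Suc k)
    have gs: "g \<mu> x > 0" "g (\<mu> + real k) x > 0" "g (\<mu> + real k + s) x > 0"
      "g (\<mu> + real (Suc k)) x > 0" "g (\<mu> + real (Suc k) + s) x > 0" "g (\<mu> + s) x > 0"
      using that by (auto intro!: pos)
    have "g (\<mu> + real k) x * g (\<mu> + real (Suc k) + s) x < g (\<mu> + real (Suc k)) x * g (\<mu> + real k + s) x"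
      using step[of "\<mu> + real k" s] that by (simp add: add_ac)
    \<comment> \<open>Multiplying the unit step at \<open>\<mu> + k\<close> with the induction
      hypothesis produces a common positive factor that cancels.\<close>
    from mult_strict_mono[OF this Suc.IH] gs
    have "(g (\<mu> + real k) x * g (\<mu> + real k + s) x) * (g \<mu> x * g (\<mu> + real (Suc k) + s) x) <
        (g (\<mu> + real k) x * g (\<mu> + real k + s) x) * (g (\<mu> + real (Suc k)) x * g (\<mu> + s) x)"
      by (simp only: mult_ac mult_pos_pos less_imp_le)
    thus ?case using gs by (simp only: mult_less_cancel_left_pos mult_pos_pos)
  qed
  thus ?thesis
    unfolding strict_discrete_wright_log_concave_on_def using pos continuous_on_g by auto
qed

end

text \<open>The exceptions lie on the boundary. For \<open>degenerate\<close> parameters the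
  determinant is identically zero, see \<open>lam_hyper_degenerate\<close>. At \<open>x = 0\<close>
  the denominator of the ratio is \<open>rGamma (\<mu> + 1) * rGamma (\<mu> + \<beta>)\<close>,
  which vanishes if \<open>\<mu> = -1\<close> or \<open>\<mu> + \<beta> = 0\<close>; otherwise the
  ratio there equals its lower bound.\<close>

theorem theorem4:
  fixes p q r :: nat and as bs :: "real list"
  assumes "length as = p" and "length bs = q" and "p \<le> q + 1" and "r = q + 1 - p"
    and "\<forall>a\<in>set as. a > 0" and "\<forall>b\<in>set bs. b > 0"
    and "\<forall>j<p. elem_sym (r + Suc j) (1 # bs) / elem_sym (Suc j) as
              \<le> elem_sym (r + j) (1 # bs) / elem_sym j as"
  shows
   "(\<forall>x\<ge>0. strict_discrete_wright_log_concave_on {0<..} (\<lambda>\<nu>. g_hyper as bs \<nu> x)) \<and>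
    (\<forall>\<mu> \<beta> :: real. \<mu> \<ge> -1 \<and> \<beta> > 0 \<and> \<mu> + \<beta> \<ge> 0 \<longrightarrow>
      (let g = g_hyper as bs; lam = lam_hyper as bs \<beta> \<mu>;
           degenerate = (\<mu> = -1 \<and> \<beta> = 1 \<and> mset as = mset (1 # bs))
       in
        (\<exists>c :: nat \<Rightarrow> real.
           (\<forall>x. (\<lambda>n. c n * x ^ n) sums lam x) \<and>
           (\<forall>n. c n \<ge> 0) \<and>
           (\<mu> > -1 \<longrightarrow> (\<forall>n. c n > 0)) \<and>
           (\<mu> = -1 \<and> \<beta> > 1 \<longrightarrow> (\<forall>n\<ge>1. c n > 0)) \<and>
           (\<mu> = -1 \<and> \<beta> = 1 \<and> \<not> degenerate \<longrightarrow> (\<forall>n\<ge>2. c n > 0))) \<and>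
        absolutely_monotonic_on {0<..} lam \<and>
        multiplicatively_convex lam \<and>
        completely_monotonic_on {0<..} (\<lambda>y. lam (1 / y)) \<and>
        (\<not> degenerate \<longrightarrow> log_convex_on {0<..} (\<lambda>y. lam (1 / y))) \<and>
        (\<exists>\<tau> :: real measure. sets \<tau> = sets borel \<and> emeasure \<tau> {..<0} = 0 \<and>
           (\<forall>x>0. set_integrable \<tau> {0..} (\<lambda>t. exp (- t / x)) \<and>
                  lam x = (LINT t:{0..}|\<tau>. exp (- t / x)))) \<and>
        (\<forall>x\<ge>0. x > 0 \<or> (\<mu> > -1 \<and> \<mu> + \<beta> > 0) \<longrightarrow>
           g (1 + \<mu>) x * g (\<beta> + \<mu>) x > 0 \<and>
           (let ratio = (g \<mu> x * g (1 + \<beta> + \<mu>) x) / (g (1 + \<mu>) x * g (\<beta> + \<mu>) x)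
            in
              (\<mu> + \<beta> > 0 \<longrightarrow>
                 \<mu> / (\<beta> + \<mu>) \<le> ratio \<and> (x > 0 \<longrightarrow> \<mu> / (\<beta> + \<mu>) < ratio)) \<and>
              ratio \<le> 1 \<and> (\<not> degenerate \<longrightarrow> ratio < 1))) \<and>
        (\<forall>x\<ge>0.
           g (\<mu> + 1) x * g (\<mu> + \<beta>) x - g \<mu> x * g (\<mu> + \<beta> + 1) x
             \<ge> \<beta> * rGamma (\<mu> + 1) * rGamma (\<mu> + \<beta> + 1) \<and>
           (\<not> degenerate \<longrightarrow>
             (g (\<mu> + 1) x * g (\<mu> + \<beta>) x - g \<mu> x * g (\<mu> + \<beta> + 1) x
                = \<beta> * rGamma (\<mu> + 1) * rGamma (\<mu> + \<beta> + 1) \<longleftrightarrow> x = 0)))))"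
proof (intro conjI allI impI, goal_cases)
  case (1 x)
  interpret hyper_params as bs
    using assms by unfold_locales auto
  from 1 show ?case by (rule g_strict_discrete_wright_log_concave)
next
  case (2 \<mu> \<beta>)
  interpret hyper_params as bs
    using assms by unfold_locales auto
  from 2 have \<mu>\<beta>: "\<mu> \<ge> -1" "\<beta> > 0" "\<mu> + \<beta> \<ge> 0" by auto
  define lam where "lam = lam_hyper as bs \<beta> \<mu>"
  define degenerate where "degenerate \<longleftrightarrow> \<mu> = -1 \<and> \<beta> = 1 \<and> mset as = mset (1 # bs)"
  note series = lam_power_series[OF \<mu>\<beta>, folded lam_def]
  have coeffs: "\<exists>c :: nat \<Rightarrow> real. (\<forall>x. (\<lambda>n. c n * x ^ n) sums lam x) \<and> (\<forall>n. c n \<ge> 0) \<and>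
      (\<mu> > -1 \<longrightarrow> (\<forall>n. c n > 0)) \<and> (\<mu> = -1 \<and> \<beta> > 1 \<longrightarrow> (\<forall>n\<ge>1. c n > 0)) \<and>
      (\<mu> = -1 \<and> \<beta> = 1 \<and> \<not> degenerate \<longrightarrow> (\<forall>n\<ge>2. c n > 0))"
    using nonneg_power_seriesD(1,2)[OF series] turan_coeff_pos[OF \<mu>\<beta>] turan_coeff_pos'[OF \<mu>\<beta>]
    by (intro exI[of _ "turan_coeff \<beta> \<mu>"]) (auto simp: degenerate_def)
  have log_convex: "\<not> degenerate \<longrightarrow> log_convex_on {0<..} (\<lambda>y. lam (1 / y))"
    using log_convex_on_power_series_inverse[OF series turan_coeff_pos'[OF \<mu>\<beta> order_refl]]
    by (simp add: degenerate_def)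
  have lam_eq: "g (\<mu> + 1) x * g (\<mu> + \<beta>) x - g \<mu> x * g (\<mu> + \<beta> + 1) x = lam x" for x
    by (simp add: lam_def lam_hyper_def)
  have ratio: "g (1 + \<mu>) x * g (\<beta> + \<mu>) x > 0 \<and>
      (let ratio = (g \<mu> x * g (1 + \<beta> + \<mu>) x) / (g (1 + \<mu>) x * g (\<beta> + \<mu>) x) in
        (\<mu> + \<beta> > 0 \<longrightarrow> \<mu> / (\<beta> + \<mu>) \<le> ratio \<and> (x > 0 \<longrightarrow> \<mu> / (\<beta> + \<mu>) < ratio)) \<and>
        ratio \<le> 1 \<and> (\<not> degenerate \<longrightarrow> ratio < 1))"
    if x: "x \<ge> 0" "x > 0 \<or> (\<mu> > -1 \<and> \<mu> + \<beta> > 0)" for x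
  proof -
    define P where "P = g (\<mu> + 1) x * g (\<mu> + \<beta>) x"
    define Q where "Q = g \<mu> x * g (\<mu> + \<beta> + 1) x"
    have P: "P > 0"
      unfolding P_def using x \<mu>\<beta> by (intro mult_pos_pos g_pos) auto
    \<comment> \<open>The lower bound with denominators cleared; the linear coefficient makes it
      strict for \<open>x > 0\<close>.\<close>
    have lower: "0 \<le> (\<mu> + \<beta>) * Q - \<mu> * P" "x > 0 \<Longrightarrow> 0 < (\<mu> + \<beta>) * Q - \<mu> * P" if "\<mu> + \<beta> > 0"
      using nonneg_power_series_nonneg[OF ratio_power_series[OF \<mu>\<beta>(1,2) that] x(1)]
        nonneg_power_series_pos[OF ratio_power_series[OF \<mu>\<beta>(1,2) that] _ ratio_coeff_pos[OF \<mu>\<beta>(1,2) that, of 1]]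
      by (simp_all add: P_def Q_def)
    have "Q \<le> P"
      using nonneg_power_series_nonneg[OF series x(1)] lam_eq[of x] by (simp add: P_def Q_def)
    moreover have "Q < P" if "\<not> degenerate"
    proof (cases "x > 0")
      case True
      thus ?thesis
        using nonneg_power_series_pos[OF series True turan_coeff_pos'[OF \<mu>\<beta> order_refl]] that lam_eq[of x]
        by (simp add: P_def Q_def degenerate_def)
    next
      case False
      \<comment> \<open>At \<open>x = 0\<close> the assumption on \<open>x\<close> forces
        \<open>\<mu> > -1\<close> and \<open>\<mu> + \<beta> > 0\<close>, so the constant term is
        positive.\<close>
      hence "lam x > 0"
        using x \<mu>\<beta> lam_0[of \<beta> \<mu>] by (auto simp: lam_def intro!: mult_pos_pos rGamma_pos)
      thus ?thesis using lam_eq[of x] by (simp add: P_def Q_def)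
    qed
    moreover have "g \<mu> x * g (1 + \<beta> + \<mu>) x = Q" "g (1 + \<mu>) x * g (\<beta> + \<mu>) x = P"
      by (simp_all add: P_def Q_def add_ac)
    ultimately show ?thesis
      using P lower by (auto simp: Let_def field_simps)
  qed
  have bound: "lam x \<ge> \<beta> * rGamma (\<mu> + 1) * rGamma (\<mu> + \<beta> + 1) \<and>
      (\<not> degenerate \<longrightarrow> (lam x = \<beta> * rGamma (\<mu> + 1) * rGamma (\<mu> + \<beta> + 1) \<longleftrightarrow> x = 0))" if "x \<ge> 0" for x
    using lam_ge[OF \<mu>\<beta> that] lam_greater[OF \<mu>\<beta>, of x] lam_0[of \<beta> \<mu>] that
    by (cases "x = 0") (auto simp: lam_def degenerate_def)
  show ?case
    \<comment> \<open>Only the outer bindings are expanded; the inner \<open>ratio\<close> keeps the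
      form of the fact proved above.\<close>
    unfolding Let_def[of "g_hyper as bs"] lam_def[symmetric] degenerate_def[symmetric]
      Let_def[of lam] Let_def[of degenerate] lam_eq
    using coeffs absolutely_monotonic_on_power_series[OF series]
      multiplicatively_convex_power_series[OF series]
      completely_monotonic_on_power_series_inverse[OF series]
      log_convex power_series_laplace_measure[OF series] ratio bound
    by (intro conjI) blast+
qed

end
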